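(* Let $G=(V,E)$ be a connected graph with $n$ vertices and maximum degree $\Delta$, let $k\in\{2,\dots,n-1\}$, let $\mathscr{S}$ be a $k$-block system for $G$ and let $\psi$ be the uniform distribution on $\mathscr{S}$. Fix $\lambda>1$. If $q\ge 2^{k+1}\Delta^{2k}k^{2k+1}\lambda^{\Delta-1+k^{-1}}$, then for every $\varepsilon>0$, $\tau(\mathcal{M}_{\mathrm{BD}}^{\mathscr{S},\psi}(G,\lambda,q),\varepsilon)\le 2n\log(n\varepsilon^{-1})$.
   Context: Potts model on $G$: configurations $\sigma\in\Omega=[q]^V$, $\mu(\sigma)$ = number of monochromatic edges, Gibbs distribution $\pi(\sigma)\propto\lambda^{\mu(\sigma)}$. $\tau(\mathcal{M},\varepsilon)=\max_x\min\{t:\|P^t(x,\cdot)-\pi\|_{TV}\le\varepsilon\}$. A $k$-block system for $G$ is a family $\mathscr{S}=\{S_v:v\in V\}$ with $v\in S_v$, $|S_v|=k$ and $G[S_v]$ connected. For $S\subseteq V$, $X\in\Omega$, $c\in[q]^S$: $X^{(S,c)}$ equals $c$ on $S$ and $X$ off $S$, and $\mu_{X,S}(c)$ is the number of monochromatic edges of $X^{(S,c)}$ incident with at least one vertex of $S$. The $(\mathscr{S},\psi)$-block dynamics $\mathcal{M}_{\mathrm{BD}}^{\mathscr{S},\psi}(G,\lambda,q)$ is the chain on $\Omega$ which from $X_t$ picks $S\in\mathscr{S}$ according to $\psi$, picks $c\in[q]^S$ with probability proportional to $\lambda^{\mu_{X_t,S}(c)}$, and moves to $X_t^{(S,c)}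$.
   Formalization: The formal theorem takes 0<ε<1 instead of every ε>0: for ε>n the claim fails (τ=0 but 2n log(n/ε)<0), and for 1≤ε≤n it is trivial since total variation is at most 1, so τ=0; the uniform ψ is read as choosing v∈V uniformly and updating S_v. *)

theory Defs
  imports Complex_Main
begin

definition simple_graph :: "'v set \<Rightarrow> ('v \<Rightarrow> 'v \<Rightarrow> bool) \<Rightarrow> bool" where
  "simple_graph V adj \<longleftrightarrow> finite V \<and> (\<forall>u v. adj u v \<longrightarrow> u \<in> V \<and> v \<in> V)
     \<and> (\<forall>u v. adj u v \<longrightarrow> adj v u) \<and> (\<forall>v. \<not> adj v v)"

definition induced_connected :: "('v \<Rightarrow> 'v \<Rightarrow> bool) \<Rightarrow> 'v set \<Rightarrow> bool" where
  "induced_connected adj S \<longleftrightarrow>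
     (\<forall>u\<in>S. \<forall>v\<in>S. (\<lambda>a b. a \<in> S \<and> b \<in> S \<and> adj a b)\<^sup>*\<^sup>* u v)"

definition connected_graph :: "'v set \<Rightarrow> ('v \<Rightarrow> 'v \<Rightarrow> bool) \<Rightarrow> bool" where
  "connected_graph V adj \<longleftrightarrow> induced_connected adj V"

definition degree :: "'v set \<Rightarrow> ('v \<Rightarrow> 'v \<Rightarrow> bool) \<Rightarrow> 'v \<Rightarrow> nat" where
  "degree V adj v = card {u \<in> V. adj v u}"

definition max_degree :: "'v set \<Rightarrow> ('v \<Rightarrow> 'v \<Rightarrow> bool) \<Rightarrow> nat" where
  "max_degree V adj = Max (degree V adj ` V)"

definition edges :: "'v set \<Rightarrow> ('v \<Rightarrow> 'v \<Rightarrow> bool) \<Rightarrow> 'v set set" where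
  "edges V adj = {{u, v} | u v. u \<in> V \<and> v \<in> V \<and> adj u v}"

definition block_system :: "'v set \<Rightarrow> ('v \<Rightarrow> 'v \<Rightarrow> bool) \<Rightarrow> nat \<Rightarrow> ('v \<Rightarrow> 'v set) \<Rightarrow> bool" where
  "block_system V adj k Sb \<longleftrightarrow>
     (\<forall>v\<in>V. v \<in> Sb v \<and> Sb v \<subseteq> V \<and> card (Sb v) = k \<and> induced_connected adj (Sb v))"

text \<open>Colours are [q] = {0..<q}; a configuration is a map V \<rightarrow> [q], represented
extensionally (value 0 outside V).\<close>
definition configs :: "'v set \<Rightarrow> nat \<Rightarrow> ('v \<Rightarrow> nat) set" where
  "configs V q = {\<sigma>. (\<forall>v\<in>V. \<sigma> v < q) \<and> (\<forall>v. v \<notin> V \<longrightarrow> \<sigma> v = 0)}"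

definition mono_edges :: "'v set \<Rightarrow> ('v \<Rightarrow> 'v \<Rightarrow> bool) \<Rightarrow> ('v \<Rightarrow> nat) \<Rightarrow> 'v set set" where
  "mono_edges V adj \<sigma> = {e \<in> edges V adj. \<exists>u v. e = {u, v} \<and> \<sigma> u = \<sigma> v}"

definition mu :: "'v set \<Rightarrow> ('v \<Rightarrow> 'v \<Rightarrow> bool) \<Rightarrow> ('v \<Rightarrow> nat) \<Rightarrow> nat" where
  "mu V adj \<sigma> = card (mono_edges V adj \<sigma>)"

definition gibbs :: "'v set \<Rightarrow> ('v \<Rightarrow> 'v \<Rightarrow> bool) \<Rightarrow> nat \<Rightarrow> real \<Rightarrow> ('v \<Rightarrow> nat) \<Rightarrow> real" where
  "gibbs V adj q lam \<sigma> =
     lam ^ mu V adj \<sigma> / (\<Sum>\<tau>\<in>configs V q. lam ^ mu V adj \<tau>)"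

definition block_colourings :: "'v set \<Rightarrow> nat \<Rightarrow> ('v \<Rightarrow> nat) set" where
  "block_colourings S q = {c. (\<forall>v\<in>S. c v < q) \<and> (\<forall>v. v \<notin> S \<longrightarrow> c v = 0)}"

definition upd_block :: "('v \<Rightarrow> nat) \<Rightarrow> 'v set \<Rightarrow> ('v \<Rightarrow> nat) \<Rightarrow> ('v \<Rightarrow> nat)" where
  "upd_block X S c = (\<lambda>v. if v \<in> S then c v else X v)"

definition mu_block :: "'v set \<Rightarrow> ('v \<Rightarrow> 'v \<Rightarrow> bool) \<Rightarrow> ('v \<Rightarrow> nat) \<Rightarrow> 'v set \<Rightarrow> ('v \<Rightarrow> nat) \<Rightarrow> nat" where
  "mu_block V adj X S c = card {e \<in> mono_edges V adj (upd_block X S c). e \<inter> S \<noteq> {}}"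

definition block_step :: "'v set \<Rightarrow> ('v \<Rightarrow> 'v \<Rightarrow> bool) \<Rightarrow> nat \<Rightarrow> real \<Rightarrow> 'v set
    \<Rightarrow> ('v \<Rightarrow> nat) \<Rightarrow> ('v \<Rightarrow> nat) \<Rightarrow> real" where
  "block_step V adj q lam S X Y =
     (\<Sum>c\<in>{c \<in> block_colourings S q. upd_block X S c = Y}. lam ^ mu_block V adj X S c)
     / (\<Sum>c\<in>block_colourings S q. lam ^ mu_block V adj X S c)"

text \<open>(S,psi)-block dynamics with psi uniform over the family {S_v : v in V}.\<close>
definition block_dynamics :: "'v set \<Rightarrow> ('v \<Rightarrow> 'v \<Rightarrow> bool) \<Rightarrow> nat \<Rightarrow> real \<Rightarrow> ('v \<Rightarrow> 'v set)
    \<Rightarrow> ('v \<Rightarrow> nat) \<Rightarrow> ('v \<Rightarrow> nat) \<Rightarrow> real" where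
  "block_dynamics V adj q lam Sb X Y =
     (\<Sum>v\<in>V. block_step V adj q lam (Sb v) X Y) / real (card V)"

fun mpow :: "'s set \<Rightarrow> ('s \<Rightarrow> 's \<Rightarrow> real) \<Rightarrow> nat \<Rightarrow> 's \<Rightarrow> 's \<Rightarrow> real" where
  "mpow \<Omega> P 0 x y = (if x = y then 1 else 0)"
| "mpow \<Omega> P (Suc t) x y = (\<Sum>z\<in>\<Omega>. mpow \<Omega> P t x z * P z y)"

definition tv_dist :: "'s set \<Rightarrow> ('s \<Rightarrow> real) \<Rightarrow> ('s \<Rightarrow> real) \<Rightarrow> real" where
  "tv_dist \<Omega> p r = (\<Sum>y\<in>\<Omega>. \<bar>p y - r y\<bar>) / 2"

definition mixing_time :: "'s set \<Rightarrow> ('s \<Rightarrow> 's \<Rightarrow> real) \<Rightarrow> ('s \<Rightarrow> real) \<Rightarrow> real \<Rightarrow> nat" where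
  "mixing_time \<Omega> P \<pi> \<epsilon> =
     Max ((\<lambda>x. LEAST t. tv_dist \<Omega> (mpow \<Omega> P t x) \<pi> \<le> \<epsilon>) ` \<Omega>)"

end

theory Submission
  imports Defs
begin

text \<open>Path coupling in dual form: one step of the chain shrinks the Lipschitz constant (for the
  Hamming distance) of every function by the factor \<open>1 - 3 / (4 n)\<close>, and total variation is a
  supremum over functions with Lipschitz constant \<open>1\<close>.

  Let two configurations differ only at \<open>v\<close>. An update of a block containing \<open>v\<close> (there is at
  least one) removes the discrepancy, and an update of a block not adjacent to \<open>v\<close> keeps it. For
  a block \<open>S\<close> adjacent to \<open>v\<close> the two update distributions differ only on colourings giving a
  neighbour \<open>w \<in> S\<close> of \<open>v\<close> one of the two colours of \<open>v\<close>. If \<open>C\<close> is the monochromatic component of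
  such a \<open>w\<close> in \<open>S\<close>, then at most \<open>|C| (\<Delta> - 1)\<close> monochromatic edges touch \<open>C\<close>, or
  \<open>k (\<Delta> - 1) + 1\<close> if \<open>C = S\<close>; comparing with a free recolouring of \<open>C\<close>, this component has
  probability at most \<open>\<rho>\<^bsup>|C|\<^esup>\<close> with \<open>\<rho> = \<lambda>\<^bsup>\<Delta> - 1 + 1/k\<^esup> / q\<close>. As at most \<open>(1 + \<Delta>)\<^bsup>k\<^esup>\<close> blocks
  are adjacent to \<open>v\<close>, the bound on \<open>q\<close> makes the expected number of new discrepancies,
  summed over all blocks, at most \<open>1/4\<close>.\<close>

section \<open>Boundaries and balls of connected vertex sets\<close>

lemma finite_edges: "simple_graph V adj \<Longrightarrow> finite (edges V adj)"
  by (rule finite_subset[of _ "Pow V"]) (auto simp: simple_graph_def edges_def)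

lemma card_edges_at_le:
  assumes "simple_graph V adj" "u \<in> V"
  shows "card {e \<in> edges V adj. u \<in> e} \<le> max_degree V adj"
proof -
  have fin: "finite V" using assms by (simp add: simple_graph_def)
  have sub: "{e \<in> edges V adj. u \<in> e} \<subseteq> (\<lambda>w. {u, w}) ` {w \<in> V. adj u w}"
    using assms unfolding edges_def simple_graph_def by blast
  have "card {e \<in> edges V adj. u \<in> e} \<le> card ((\<lambda>w. {u, w}) ` {w \<in> V. adj u w})"
    using fin by (intro card_mono sub) auto
  also have "\<dots> \<le> degree V adj u"
    unfolding degree_def using fin by (intro card_image_le) auto
  also have "\<dots> \<le> max_degree V adj"
    unfolding max_degree_def using fin assms(2) by (intro Max_ge) auto
  finally show ?thesis .
qed

text \<open>Equivalent to reachability of all of \<open>C\<close> from \<open>w\<close> by paths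
  inside \<open>C\<close>. The form with cuts suits the inductions below, which enlarge a proper
  part of \<open>C\<close> across one edge at a time.\<close>

definition spanned_from :: "('v \<Rightarrow> 'v \<Rightarrow> bool) \<Rightarrow> 'v \<Rightarrow> 'v set \<Rightarrow> bool" where
  "spanned_from adj w C \<longleftrightarrow>
     w \<in> C \<and> (\<forall>T. w \<in> T \<and> T \<subset> C \<longrightarrow> (\<exists>a\<in>T. \<exists>b\<in>C - T. adj a b))"

text \<open>A set \<open>T\<close> that contains \<open>w\<close> and has no edge to the rest is
  closed under \<open>R\<close>, so it already contains everything reachable. The relation is
  arbitrary in order to serve both connected blocks and monochromatic components.\<close>

lemma spanned_from_reachable:
  assumes "\<And>a b. R a b \<Longrightarrow> adj a b"
  shows "spanned_from adj w {u. R\<^sup>*\<^sup>* w u}"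
  unfolding spanned_from_def
proof (intro conjI allI impI)
  fix T assume T: "w \<in> T \<and> T \<subset> {u. R\<^sup>*\<^sup>* w u}"
  show "\<exists>a\<in>T. \<exists>b\<in>{u. R\<^sup>*\<^sup>* w u} - T. adj a b"
  proof (rule ccontr)
    assume no: "\<not> ?thesis"
    have "u \<in> T" if "R\<^sup>*\<^sup>* w u" for u
      using that
    proof induction
      case (step y z)
      then show ?case using no assms[of y z] rtranclp.rtrancl_into_rtrancl[of R w y z] by blast
    qed (use T in auto)
    then show False using T by blast
  qed
qed auto

lemma spanned_from_induced_connected:
  assumes "induced_connected adj S" "w \<in> S"
  shows "spanned_from adj w S"
proof -
  let ?R = "\<lambda>a b. a \<in> S \<and> b \<in> S \<and> adj a b"
  have "u \<in> S" if "?R\<^sup>*\<^sup>* w u" for u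
    using that assms(2) by induction auto
  then have "S = {u. ?R\<^sup>*\<^sup>* w u}"
    using assms unfolding induced_connected_def by blast
  moreover have "spanned_from adj w {u. ?R\<^sup>*\<^sup>* w u}"
    by (rule spanned_from_reachable) simp
  ultimately show ?thesis by simp
qed

text \<open>A cut \<open>T\<close> that misses \<open>S\<close> is crossed by the edge from
  \<open>v\<close> to \<open>z\<close>; any other cut restricts to a cut of the connected set
  \<open>S\<close>. A block adjacent to \<open>v\<close> thus becomes a connected set around
  \<open>v\<close>.\<close>

lemma spanned_from_insert_neighbour:
  assumes "induced_connected adj S" "z \<in> S" "adj v z"
  shows "spanned_from adj v (insert v S)"
  unfolding spanned_from_def
proof (intro conjI allI impI)
  fix T assume T: "v \<in> T \<and> T \<subset> insert v S"
  show "\<exists>a\<in>T. \<exists>b\<in>insert v S - T. adj a b"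
  proof (cases "T \<inter> S = {}")
    case True
    then show ?thesis using T assms by blast
  next
    case False
    then obtain w where w: "w \<in> T" "w \<in> S" by blast
    have "spanned_from adj w S" by (rule spanned_from_induced_connected) (use assms w in auto)
    moreover have "w \<in> T \<inter> S \<and> T \<inter> S \<subset> S" using T w by blast
    ultimately have "\<exists>a\<in>T \<inter> S. \<exists>b\<in>S - T \<inter> S. adj a b"
      unfolding spanned_from_def by blast
    then show ?thesis by blast
  qed
qed auto

text \<open>Growing \<open>C\<close> from \<open>w\<close>, each new vertex brings at most \<open>\<Delta> - 1\<close> new edges,
  because one of its edges already touches the part built so far.\<close>
lemma card_edges_touching_le:
  assumes G: "simple_graph V adj" and C: "C \<subseteq> V" "spanned_from adj w C"
  shows "card {e \<in> edges V adj. e \<inter> C \<noteq> {}} \<le> card C * (max_degree V adj - 1) + 1"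
proof -
  let ?D = "max_degree V adj"
  let ?E = "\<lambda>T. {e \<in> edges V adj. e \<inter> T \<noteq> {}}"
  have fin: "finite V" using G by (simp add: simple_graph_def)
  have finC: "finite C" using C fin finite_subset by blast
  have finE: "finite (?E T)" for T using finite_edges[OF G] by auto
  have wC: "w \<in> C" using C by (simp add: spanned_from_def)
  have grow: "\<exists>T\<subseteq>C. w \<in> T \<and> card T = Suc m \<and> card (?E T) \<le> Suc m * (?D - 1) + 1" if "m < card C" for m
    using that
  proof (induction m)
    case 0
    \<comment> \<open>The first vertex may bring \<Delta> edges, one more than each later vertex;
      this is the source of the summand 1.\<close>
    have "card (?E {w}) \<le> ?D" using card_edges_at_le[OF G, of w] wC C by auto
    then show ?case using wC by (intro exI[of _ "{w}"]) auto
  next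
    case (Suc m)
    then obtain T where T: "T \<subseteq> C" "w \<in> T" "card T = Suc m" "card (?E T) \<le> Suc m * (?D - 1) + 1"
      by auto
    have "T \<subset> C" using T Suc.prems by auto
    then obtain a b where ab: "a \<in> T" "b \<in> C - T" "adj a b"
      using C T unfolding spanned_from_def by blast
    let ?N = "{e \<in> edges V adj. b \<in> e}"
    have abN: "{a, b} \<in> ?N" "{a,b} \<in> ?E T" using ab T C unfolding edges_def by auto
    have finN: "finite ?N" using finite_edges[OF G] by auto
    have "?E (insert b T) \<subseteq> ?E T \<union> (?N - {{a, b}})" using abN by auto
    then have "card (?E (insert b T)) \<le> card (?E T \<union> (?N - {{a, b}}))"
      using finE finN by (intro card_mono) auto
    also have "\<dots> \<le> card (?E T) + card (?N - {{a, b}})" by (rule card_Un_le)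
    also have "card (?N - {{a, b}}) \<le> ?D - 1"
      using card_edges_at_le[OF G, of b] ab C abN by auto
    finally have "card (?E (insert b T)) \<le> Suc (Suc m) * (?D - 1) + 1" using T by simp
    moreover have "card (insert b T) = Suc (Suc m)"
      using T ab finC finite_subset[of T C] by simp
    ultimately show ?case using T ab by (intro exI[of _ "insert b T"]) auto
  qed
  have C1: "Suc (card C - 1) = card C"
    using wC finC card_gt_0_iff[of C] by auto
  then have "card C - 1 < card C" by linarith
  from grow[OF this] obtain T where T: "T \<subseteq> C" "card T = card C"
      "card (?E T) \<le> card C * (?D - 1) + 1"
    unfolding C1 by blast
  then have "T = C" using finC card_subset_eq by blast
  then show ?thesis using T by simp
qed

section \<open>Balls in the graph and the number of blocks adjacent to a vertex\<close>

definition closed_nbhd :: "('v \<Rightarrow> 'v \<Rightarrow> bool) \<Rightarrow> 'v set \<Rightarrow> 'v set" where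
  "closed_nbhd adj A = A \<union> {b. \<exists>a\<in>A. adj a b}"

text \<open>The \<open>m\<close>-fold iterate at \<open>{v}\<close> is the ball of radius
  \<open>m\<close> around \<open>v\<close>. Each of its vertices adds at most \<Delta> new ones, so
  a unit of radius costs a factor of at most 1 + \<Delta>.\<close>

lemma card_iterated_nbhd_le:
  assumes G: "simple_graph V adj" and v: "v \<in> V"
  shows "(closed_nbhd adj ^^ m) {v} \<subseteq> V \<and>
    card ((closed_nbhd adj ^^ m) {v}) \<le> (1 + max_degree V adj) ^ m"
proof (induction m)
  case 0
  then show ?case using v by simp
next
  case (Suc m)
  let ?A = "(closed_nbhd adj ^^ m) {v}"
  have fin: "finite V" using G by (simp add: simple_graph_def)
  then have finA: "finite ?A" using Suc finite_subset by blast
  have sub: "closed_nbhd adj ?A \<subseteq> V"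
    using Suc G unfolding closed_nbhd_def simple_graph_def by blast
  have deg: "card {b \<in> V. adj a b} \<le> max_degree V adj" if "a \<in> ?A" for a
    unfolding max_degree_def degree_def[symmetric]
    using fin that Suc by (intro Max_ge) auto
  have "closed_nbhd adj ?A \<subseteq> ?A \<union> (\<Union>a\<in>?A. {b \<in> V. adj a b})"
    using sub unfolding closed_nbhd_def by auto
  then have "card (closed_nbhd adj ?A) \<le> card (?A \<union> (\<Union>a\<in>?A. {b \<in> V. adj a b}))"
    using finA fin by (intro card_mono) auto
  also have "\<dots> \<le> card ?A + card (\<Union>a\<in>?A. {b \<in> V. adj a b})" by (rule card_Un_le)
  also have "\<dots> \<le> card ?A + (\<Sum>a\<in>?A. card {b \<in> V. adj a b})"
    using card_UN_le[OF finA] by auto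
  also have "\<dots> \<le> card ?A + card ?A * max_degree V adj"
    using sum_mono[OF deg, of ?A "\<lambda>x. x"] by simp
  also have "\<dots> = card ?A * (1 + max_degree V adj)" by simp
  also have "\<dots> \<le> (1 + max_degree V adj) ^ m * (1 + max_degree V adj)"
    using Suc by (intro mult_right_mono) auto
  finally show ?case using sub by (simp add: mult.commute)
qed

text \<open>As long as the ball misses part of \<open>C\<close>, an edge of \<open>C\<close> leaves
  their intersection, and its endpoint is caught by the next radius. So \<open>m\<close> steps catch
  at least \<open>Suc m\<close> vertices or all of \<open>C\<close>.\<close>

lemma spanned_subset_iterated_nbhd:
  assumes "spanned_from adj v C" "finite C" "card C \<le> Suc m"
  shows "C \<subseteq> (closed_nbhd adj ^^ m) {v}"
proof -
  have "v \<in> (closed_nbhd adj ^^ i) {v} \<and>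
    (C \<subseteq> (closed_nbhd adj ^^ i) {v} \<or> Suc i \<le> card (C \<inter> (closed_nbhd adj ^^ i) {v}))" for i
  proof (induction i)
    case 0
    then show ?case using assms by (auto simp: spanned_from_def)
  next
    case (Suc i)
    let ?A = "(closed_nbhd adj ^^ i) {v}" and ?A' = "(closed_nbhd adj ^^ Suc i) {v}"
    have sub: "?A \<subseteq> ?A'" by (simp add: closed_nbhd_def)
    show ?case
    proof (cases "C \<subseteq> ?A")
      case False
      then have "v \<in> C \<inter> ?A \<and> C \<inter> ?A \<subset> C" using Suc assms by (auto simp: spanned_from_def)
      then obtain a b where ab: "a \<in> C \<inter> ?A" "b \<in> C - ?A" "adj a b"
        using assms(1) unfolding spanned_from_def by blast
      then have "b \<in> ?A'" by (auto simp: closed_nbhd_def)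
      then have "insert b (C \<inter> ?A) \<subseteq> C \<inter> ?A'" using sub ab by blast
      then have "card (insert b (C \<inter> ?A)) \<le> card (C \<inter> ?A')"
        using assms by (intro card_mono) auto
      moreover have "card (insert b (C \<inter> ?A)) = Suc (card (C \<inter> ?A))"
        using assms ab by (intro card_insert_disjoint) auto
      ultimately show ?thesis using Suc False sub by auto
    qed (use Suc sub in blast)
  qed
  from this[of m] show ?thesis
    using assms card_seteq[of C "C \<inter> (closed_nbhd adj ^^ m) {v}"] by auto
qed

text \<open>Blocks are counted by their index \<open>u\<close>, which lies in its own block.
  Together with \<open>v\<close> the block is a connected set of \<open>k + 1\<close> vertices, so
  \<open>u\<close> lies in the ball of radius \<open>k\<close> around \<open>v\<close>.\<close>

lemma card_adjacent_blocks_le: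
  assumes G: "simple_graph V adj" and B: "block_system V adj k Sb" and v: "v \<in> V"
  shows "card {u \<in> V. v \<notin> Sb u \<and> (\<exists>z\<in>Sb u. adj v z)} \<le> (1 + max_degree V adj) ^ k"
proof -
  let ?A = "(closed_nbhd adj ^^ k) {v}"
  have fin: "finite V" using G by (simp add: simple_graph_def)
  have A: "?A \<subseteq> V" "card ?A \<le> (1 + max_degree V adj) ^ k"
    using card_iterated_nbhd_le[OF G v, of k] by auto
  have "u \<in> ?A" if u: "u \<in> V" "v \<notin> Sb u" "z \<in> Sb u" "adj v z" for u z
  proof -
    have S: "u \<in> Sb u" "Sb u \<subseteq> V" "card (Sb u) = k" "induced_connected adj (Sb u)"
      using B u by (auto simp: block_system_def)
    then have "finite (Sb u)" using fin finite_subset by blast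
    then have "insert v (Sb u) \<subseteq> ?A"
      using S u by (intro spanned_subset_iterated_nbhd spanned_from_insert_neighbour[of _ _ z]) auto
    then show ?thesis using S by blast
  qed
  then have "card {u \<in> V. v \<notin> Sb u \<and> (\<exists>z\<in>Sb u. adj v z)} \<le> card ?A"
    using A fin finite_subset by (intro card_mono) auto
  then show ?thesis using A by simp
qed

section \<open>Monochromatic components of a block\<close>

lemma mono_edges_doubleton:
  "{a, b} \<in> mono_edges V adj \<sigma> \<longleftrightarrow> {a, b} \<in> edges V adj \<and> \<sigma> a = \<sigma> b"
  unfolding mono_edges_def by (auto simp: doubleton_eq_iff)

lemma edges_doubleton:
  "simple_graph V adj \<Longrightarrow> {a, b} \<in> edges V adj \<longleftrightarrow> adj a b"
  unfolding edges_def simple_graph_def by (auto simp: doubleton_eq_iff)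

lemma finite_block_colourings: "finite S \<Longrightarrow> finite (block_colourings S q)"
  using finite_set_of_finite_funs[of S "{..<q}" 0]
  by (rule finite_subset[rotated]) (auto simp: block_colourings_def)

lemma configs_eq_block_colourings: "configs V q = block_colourings V q"
  by (simp add: configs_def block_colourings_def)

text \<open>A colouring of a disjoint union is a pair of colourings of the parts. Since
  \<open>block_colourings\<close> vanish off their domain, restriction and gluing by
  \<open>upd_block\<close> are mutually inverse.\<close>

lemma sum_block_colourings_Un:
  assumes "C \<inter> R = {}"
  shows "(\<Sum>c\<in>block_colourings (C \<union> R) q. g c) =
    (\<Sum>e\<in>block_colourings R q. \<Sum>d\<in>block_colourings C q. g (upd_block e C d))"
proof -
  have "(\<Sum>c\<in>block_colourings (C \<union> R) q. g c) =
      (\<Sum>(e, d)\<in>block_colourings R q \<times> block_colourings C q. g (upd_block e C d))"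
    by (rule sum.reindex_bij_witness[where i = "\<lambda>(e, d). upd_block e C d" and
          j = "\<lambda>c. (\<lambda>v. if v \<in> R then c v else 0, \<lambda>v. if v \<in> C then c v else 0)"])
       (use assms in \<open>auto simp: block_colourings_def upd_block_def fun_eq_iff intro!: arg_cong[of _ _ g]\<close>)
  then show ?thesis by (simp add: sum.cartesian_product)
qed

lemma card_block_colourings:
  fixes S :: "'v set"
  assumes "finite S"
  shows "card (block_colourings S q) = q ^ card S"
  using assms
proof induction
  case empty
  have "block_colourings ({} :: 'v set) q = {\<lambda>_. 0}" by (auto simp: block_colourings_def)
  then show ?case by simp
next
  case (insert u S)
  have "block_colourings {u} q = (\<lambda>i. (\<lambda>_. 0)(u := i)) ` {..<q}"
  proof (intro equalityI subsetI)
    fix c assume "c \<in> block_colourings {u} q"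
    then have "c = (\<lambda>_. 0)(u := c u)" "c u < q" by (auto simp: block_colourings_def)
    then show "c \<in> (\<lambda>i. (\<lambda>_. 0)(u := i)) ` {..<q}" by blast
  qed (auto simp: block_colourings_def)
  moreover have "inj_on (\<lambda>i. (\<lambda>_. 0)(u := i)) {..<q}"
    by (metis fun_upd_same inj_onI)
  ultimately have "card (block_colourings {u} q) = q" by (simp add: card_image)
  then show ?case
    using sum_block_colourings_Un[of "{u}" S "\<lambda>_. 1 :: nat" q] insert by simp
qed

lemma mono_edges_avoiding_cong:
  assumes eq: "\<And>v. v \<notin> C \<Longrightarrow> \<sigma> v = \<tau> v"
  shows "{e \<in> mono_edges V adj \<sigma>. e \<inter> C = {}} = {e \<in> mono_edges V adj \<tau>. e \<inter> C = {}}"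
proof -
  have "e \<in> mono_edges V adj \<sigma> \<longleftrightarrow> e \<in> mono_edges V adj \<tau>" if e: "e \<inter> C = {}" "e \<in> edges V adj" for e
  proof -
    obtain a b where ab: "e = {a, b}" using e(2) by (auto simp: edges_def)
    then have "\<sigma> a = \<tau> a" "\<sigma> b = \<tau> b" using e eq[of a] eq[of b] by auto
    then show ?thesis by (simp add: ab mono_edges_doubleton)
  qed
  moreover have "mono_edges V adj \<sigma> \<subseteq> edges V adj" "mono_edges V adj \<tau> \<subseteq> edges V adj"
    unfolding mono_edges_def by blast+
  ultimately show ?thesis by blast
qed

definition mono_component :: "('v \<Rightarrow> 'v \<Rightarrow> bool) \<Rightarrow> 'v set \<Rightarrow> ('v \<Rightarrow> nat) \<Rightarrow> 'v \<Rightarrow> 'v set" where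
  "mono_component adj S c w = {u. (\<lambda>a b. a \<in> S \<and> b \<in> S \<and> adj a b \<and> c a = c b)\<^sup>*\<^sup>* w u}"

lemma mono_component_self: "w \<in> mono_component adj S c w"
  by (simp add: mono_component_def)

lemma mono_component_subset: "w \<in> S \<Longrightarrow> mono_component adj S c w \<subseteq> S"
proof
  fix u assume "w \<in> S" "u \<in> mono_component adj S c w"
  then show "u \<in> S"
    unfolding mono_component_def mem_Collect_eq by (metis (no_types, lifting) rtranclp.cases)
qed

lemma mono_component_colour: "u \<in> mono_component adj S c w \<Longrightarrow> c u = c w"
  unfolding mono_component_def mem_Collect_eq
  by (induction rule: rtranclp_induct) auto

lemma mono_component_step:
  "\<lbrakk>a \<in> mono_component adj S c w; a \<in> S; b \<in> S; adj a b; c a = c b\<rbrakk>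
    \<Longrightarrow> b \<in> mono_component adj S c w"
  unfolding mono_component_def mem_Collect_eq
  by (rule rtranclp.rtrancl_into_rtrancl) auto

lemma spanned_from_mono_component: "spanned_from adj w (mono_component adj S c w)"
  unfolding mono_component_def by (rule spanned_from_reachable) simp

text \<open>A monochromatic component smaller than the block has a boundary edge inside the block,
  which is not monochromatic; this saves a factor \<open>\<lambda>\<close>.\<close>
lemma card_mono_edges_component_le:
  assumes G: "simple_graph V adj" and S: "S \<subseteq> V" "induced_connected adj S" "w \<in> S"
  shows "card {e \<in> mono_edges V adj (upd_block X S c). e \<inter> mono_component adj S c w \<noteq> {}}
    \<le> card (mono_component adj S c w) * (max_degree V adj - 1)
       + (if mono_component adj S c w = S then 1 else 0)"
    (is "card ?M \<le> card ?C * (?D - 1) + _")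
proof -
  let ?E = "{e \<in> edges V adj. e \<inter> ?C \<noteq> {}}"
  have CS: "?C \<subseteq> S" using S mono_component_subset by metis
  have E: "card ?E \<le> card ?C * (?D - 1) + 1"
    by (rule card_edges_touching_le[OF G _ spanned_from_mono_component]) (use CS S in auto)
  have ME: "?M \<subseteq> ?E" by (auto simp: mono_edges_def)
  have finE: "finite ?E" using finite_edges[OF G] by simp
  show ?thesis
  proof (cases "?C = S")
    case True
    then show ?thesis using card_mono[OF finE ME] E by simp
  next
    case False
    then obtain a b where ab: "a \<in> ?C" "b \<in> S - ?C" "adj a b"
      using spanned_from_induced_connected[OF S(2,3)] CS mono_component_self
      unfolding spanned_from_def by (metis psubsetI)
    then have aS: "a \<in> S" using CS by auto
    then have "c a \<noteq> c b" using ab mono_component_step[of a adj S c w b] by auto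
    then have "{a, b} \<notin> ?M" using ab aS by (auto simp: mono_edges_doubleton upd_block_def)
    moreover have "{a, b} \<in> ?E" using ab edges_doubleton[OF G] by auto
    ultimately have "?M \<subset> ?E" using ME by blast
    then have "card ?M < card ?E" by (rule psubset_card_mono[OF finE])
    then show ?thesis using E False by simp
  qed
qed

section \<open>Weights of block colourings\<close>

locale potts =
  fixes V :: "'v set" and adj :: "'v \<Rightarrow> 'v \<Rightarrow> bool" and q :: nat and lam :: real
  assumes G: "simple_graph V adj" and q_pos: "0 < q" and lam_ge: "1 \<le> lam"
begin

abbreviation block_weight :: "('v \<Rightarrow> nat) \<Rightarrow> 'v set \<Rightarrow> ('v \<Rightarrow> nat) \<Rightarrow> real" where
  "block_weight X S c \<equiv> lam ^ mu_block V adj X S c"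

definition block_Z :: "('v \<Rightarrow> nat) \<Rightarrow> 'v set \<Rightarrow> real" where
  "block_Z X S = (\<Sum>c\<in>block_colourings S q. block_weight X S c)"

lemma finV: "finite V"
  using G by (simp add: simple_graph_def)

lemma finite_mono_edges: "finite (mono_edges V adj \<sigma>)"
  using finite_edges[OF G] by (simp add: mono_edges_def)

lemma zero_block_colouring: "(\<lambda>_. 0) \<in> block_colourings S q"
  using q_pos by (simp add: block_colourings_def)

lemma block_Z_pos: "S \<subseteq> V \<Longrightarrow> 0 < block_Z X S"
  unfolding block_Z_def
  using finite_block_colourings[of S q] finV finite_subset zero_block_colouring[of S] lam_ge
  by (intro sum_pos) auto

text \<open>A Peierls argument. The colours on \<open>C\<close> can be erased without loss of
  information, as they all equal \<open>a\<close>, and this lowers the weight by at most the factor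
  \<open>lam ^ m\<close>. Every erased colouring then extends to \<open>C\<close> in
  \<open>q ^ card C\<close> ways, and all these extensions are present in
  \<open>block_Z X S\<close>.\<close>

lemma sum_weight_constant_on_le:
  assumes S: "S \<subseteq> V" and C: "C \<subseteq> S"
    and A: "A \<subseteq> {c \<in> block_colourings S q. \<forall>u\<in>C. c u = a}"
    and m: "\<And>c. c \<in> A \<Longrightarrow> card {e \<in> mono_edges V adj (upd_block X S c). e \<inter> C \<noteq> {}} \<le> m"
  shows "(\<Sum>c\<in>A. block_weight X S c) * real q ^ card C \<le> lam ^ m * block_Z X S"
proof -
  \<comment> \<open>\<open>h c\<close> depends only on the colours off \<open>C\<close>; on
    \<open>A\<close> the exponent of the weight lies between \<open>h c\<close> and
    \<open>m + h c\<close>.\<close>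
  define h where
    "h c = card {e \<in> mono_edges V adj (upd_block X S c). e \<inter> S \<noteq> {} \<and> e \<inter> C = {}}" for c
  \<comment> \<open>Erasing means the default colour 0, so that the result is a block colouring of
    \<open>S - C\<close>.\<close>
  define res :: "('v \<Rightarrow> nat) \<Rightarrow> 'v \<Rightarrow> nat" where "res c = (\<lambda>v. if v \<in> C then 0 else c v)" for c
  let ?R = "S - C"
  let ?Q = "\<Sum>e\<in>block_colourings ?R q. lam ^ h e"
  have finS: "finite S" "finite C" "finite ?R"
    using finite_subset[OF S finV] C finite_subset by auto
  have h_cong: "h c = h d" if cd: "\<And>v. v \<notin> C \<Longrightarrow> c v = d v" for c d
  proof -
    have "{e \<in> mono_edges V adj (upd_block X S c). e \<inter> C = {}}
        = {e \<in> mono_edges V adj (upd_block X S d). e \<inter> C = {}}"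
      by (rule mono_edges_avoiding_cong) (simp add: upd_block_def cd)
    then have "{e \<in> mono_edges V adj (upd_block X S c). e \<inter> S \<noteq> {} \<and> e \<inter> C = {}}
        = {e \<in> mono_edges V adj (upd_block X S d). e \<inter> S \<noteq> {} \<and> e \<inter> C = {}}" by blast
    then show ?thesis by (simp add: h_def)
  qed
  have upper: "mu_block V adj X S c \<le> m + h c" if "c \<in> A" for c
  proof -
    have "mu_block V adj X S c \<le> card ({e \<in> mono_edges V adj (upd_block X S c). e \<inter> S \<noteq> {} \<and> e \<inter> C = {}}
        \<union> {e \<in> mono_edges V adj (upd_block X S c). e \<inter> C \<noteq> {}})"
      unfolding mu_block_def using finite_mono_edges by (intro card_mono) auto
    also have "\<dots> \<le> h c + card {e \<in> mono_edges V adj (upd_block X S c). e \<inter> C \<noteq> {}}"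
      unfolding h_def by (rule card_Un_le)
    finally show ?thesis using m[OF that] by linarith
  qed
  have lower: "h c \<le> mu_block V adj X S c" for c
    unfolding mu_block_def h_def using finite_mono_edges by (intro card_mono) auto
  have const: "c v = a" if "c \<in> A" "v \<in> C" for c v using A that by blast
  have inj: "inj_on res A"
  proof (rule inj_onI)
    fix c d assume cd: "c \<in> A" "d \<in> A" "res c = res d"
    show "c = d"
    proof
      fix v show "c v = d v"
        using const[OF cd(1)] const[OF cd(2)] fun_cong[OF cd(3), of v]
        by (cases "v \<in> C") (auto simp: res_def)
    qed
  qed
  have img: "res ` A \<subseteq> block_colourings ?R q"
    using A by (fastforce simp: block_colourings_def res_def)
  have "(\<Sum>c\<in>A. block_weight X S c) \<le> (\<Sum>c\<in>A. lam ^ m * lam ^ h (res c))"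
  proof (rule sum_mono)
    fix c assume "c \<in> A"
    then have "block_weight X S c \<le> lam ^ (m + h c)" using upper lam_ge by (intro power_increasing)
    also have "h c = h (res c)" by (rule h_cong) (simp add: res_def)
    finally show "block_weight X S c \<le> lam ^ m * lam ^ h (res c)" by (simp add: power_add)
  qed
  also have "\<dots> = lam ^ m * (\<Sum>c\<in>A. lam ^ h (res c))" by (simp add: sum_distrib_left)
  also have "(\<Sum>c\<in>A. lam ^ h (res c)) = (\<Sum>e\<in>res ` A. lam ^ h e)"
    using inj by (simp add: sum.reindex)
  also have "lam ^ m * \<dots> \<le> lam ^ m * ?Q"
    by (rule mult_left_mono[OF sum_mono2[OF finite_block_colourings[OF finS(3)] img]]) (use lam_ge in auto)
  finally have "(\<Sum>c\<in>A. block_weight X S c) * real q ^ card C \<le> lam ^ m * ?Q * real q ^ card C"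
    by (rule mult_right_mono) simp
  also have "\<dots> = lam ^ m * (real q ^ card C * ?Q)" by (simp only: mult_ac)
  also have "real q ^ card C * ?Q
      = (\<Sum>e\<in>block_colourings ?R q. \<Sum>d\<in>block_colourings C q. lam ^ h (upd_block e C d))"
  proof -
    have "h (upd_block e C d) = h e" for e d
      by (rule h_cong) (simp add: upd_block_def)
    then show ?thesis using card_block_colourings[OF finS(2), of q] by (simp add: sum_distrib_left)
  qed
  also have "\<dots> = (\<Sum>c\<in>block_colourings S q. lam ^ h c)"
  proof -
    have "C \<union> (S - C) = S" using C by auto
    then show ?thesis using sum_block_colourings_Un[of C ?R "\<lambda>c. lam ^ h c" q] by simp
  qed
  also have "lam ^ m * \<dots> \<le> lam ^ m * block_Z X S"
    unfolding block_Z_def using lam_ge lower by (intro mult_left_mono sum_mono power_increasing) auto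
  finally show ?thesis .
qed

text \<open>The colourings are split by the component \<open>C\<close> of \<open>w\<close>. There
  are at most \<open>2 ^ (card S - 1)\<close> candidates, and by the Peierls bound each carries at
  most the fraction \<rho> of the total weight.\<close>

lemma sum_weight_colour_le:
  assumes S: "S \<subseteq> V" "induced_connected adj S" "w \<in> S"
    and \<rho>: "0 < \<rho>" "\<rho> \<le> 1" "lam ^ (max_degree V adj - 1) \<le> \<rho> * real q"
      "lam ^ (card S * (max_degree V adj - 1) + 1) \<le> (\<rho> * real q) ^ card S"
  shows "(\<Sum>c | c \<in> block_colourings S q \<and> c w = a. block_weight X S c)
    \<le> 2 ^ (card S - 1) * \<rho> * block_Z X S"
proof -
  let ?B = "{c. c \<in> block_colourings S q \<and> c w = a}"
  let ?T = "{C. C \<subseteq> S \<and> w \<in> C}"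
  have finS: "finite S" using S finV finite_subset by blast
  have finB: "finite ?B" using finite_block_colourings[OF finS, of q] by simp
  have finT: "finite ?T" using finS by simp
  have "?T \<subseteq> insert w ` Pow (S - {w})"
  proof
    fix C assume "C \<in> ?T"
    then have "C = insert w (C - {w})" "C - {w} \<in> Pow (S - {w})" by auto
    then show "C \<in> insert w ` Pow (S - {w})" by blast
  qed
  then have "card ?T \<le> card (insert w ` Pow (S - {w}))" using finS by (intro card_mono) auto
  also have "\<dots> \<le> card (Pow (S - {w}))" using finS by (intro card_image_le) auto
  also have "\<dots> = 2 ^ (card S - 1)" using finS S by (simp add: card_Pow)
  finally have cardT: "card ?T \<le> 2 ^ (card S - 1)" .
  have each: "(\<Sum>c\<in>{c \<in> ?B. mono_component adj S c w = C}. block_weight X S c) \<le> \<rho> * block_Z X S"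
    if C: "C \<in> ?T" for C
  proof -
    let ?A = "{c \<in> ?B. mono_component adj S c w = C}"
    let ?m = "card C * (max_degree V adj - 1) + (if C = S then 1 else 0)"
    have "finite C" using C finS finite_subset by blast
    then have C0: "0 < card C" using C by (auto simp: card_gt_0_iff)
    have Z: "0 < block_Z X S" by (rule block_Z_pos[OF S(1)])
    have le: "(\<Sum>c\<in>?A. block_weight X S c) * real q ^ card C \<le> lam ^ ?m * block_Z X S"
    proof (rule sum_weight_constant_on_le[OF S(1), where a = a])
      show "?A \<subseteq> {c \<in> block_colourings S q. \<forall>u\<in>C. c u = a}"
        using mono_component_colour[of _ adj S _ w] by auto
      show "card {e \<in> mono_edges V adj (upd_block X S c). e \<inter> C \<noteq> {}} \<le> ?m" if "c \<in> ?A" for c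
        using card_mono_edges_component_le[OF G S, of X c] that by auto
    qed (use C in auto)
    \<comment> \<open>A proper part of the block pays for \<Delta> - 1 edges per vertex. Only for
      \<open>C = S\<close> is there one more edge, whose cost is shared by all vertices of the
      block; hence the two separate assumptions on \<rho>.\<close>
    have "lam ^ ?m \<le> (\<rho> * real q) ^ card C"
    proof (cases "C = S")
      case False
      have "lam ^ (card C * (max_degree V adj - 1)) = (lam ^ (max_degree V adj - 1)) ^ card C"
        by (metis power_mult mult.commute)
      also have "\<dots> \<le> (\<rho> * real q) ^ card C" using \<rho> lam_ge by (intro power_mono) auto
      finally show ?thesis using False by simp
    qed (use \<rho> in simp)
    also have "\<dots> = \<rho> ^ card C * real q ^ card C" by (simp add: power_mult_distrib)
    also have "\<dots> \<le> \<rho> * real q ^ card C"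
      using power_decreasing[of 1 "card C" \<rho>] C0 \<rho> by (intro mult_right_mono) auto
    finally have "lam ^ ?m * block_Z X S \<le> \<rho> * real q ^ card C * block_Z X S"
      using Z by (intro mult_right_mono) auto
    then have "(\<Sum>c\<in>?A. block_weight X S c) * real q ^ card C \<le> \<rho> * block_Z X S * real q ^ card C"
      using le by (simp only: mult_ac)
    then show ?thesis using q_pos by simp
  qed
  have "(\<Sum>c\<in>?B. block_weight X S c)
      = (\<Sum>C\<in>?T. \<Sum>c\<in>{c \<in> ?B. mono_component adj S c w = C}. block_weight X S c)"
    using mono_component_self[of w adj S] mono_component_subset[OF S(3), of adj]
    by (intro sum.group[symmetric] finB finT) auto
  also have "\<dots> \<le> (\<Sum>C\<in>?T. \<rho> * block_Z X S)" by (intro sum_mono each)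
  also have "\<dots> = real (card ?T) * (\<rho> * block_Z X S)" by simp
  also have "\<dots> \<le> 2 ^ (card S - 1) * (\<rho> * block_Z X S)"
  proof (rule mult_right_mono)
    show "real (card ?T) \<le> 2 ^ (card S - 1)" using of_nat_mono[OF cardT, where 'a = real] by simp
    show "0 \<le> \<rho> * block_Z X S" using \<rho> block_Z_pos[OF S(1), of X] by simp
  qed
  finally show ?thesis by (simp add: mult_ac)
qed

end

section \<open>Comparing block updates of neighbouring configurations\<close>

text \<open>The case in which \<open>wx\<close> has the larger total and the test function is
  nonnegative. Off \<open>B\<close> the equal weights are divided by the larger total, so these
  terms are nonpositive; on \<open>B\<close> the \<open>wy\<close> part is dropped.\<close>

lemma weighted_average_diff_le_aux:
  fixes wx wy g :: "'a \<Rightarrow> real"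
  assumes fin: "finite A" and pos: "\<And>c. c \<in> A \<Longrightarrow> 0 \<le> wx c" "\<And>c. c \<in> A \<Longrightarrow> 0 \<le> wy c"
    and Z: "0 < sum wy A" "sum wy A \<le> sum wx A"
    and eq: "\<And>c. c \<in> A \<Longrightarrow> c \<notin> B \<Longrightarrow> wx c = wy c"
    and B: "sum wx (A \<inter> B) \<le> \<beta> * sum wx A"
    and g: "\<And>c. c \<in> A \<Longrightarrow> 0 \<le> g c" "\<And>c. c \<in> A \<Longrightarrow> g c \<le> M" and M: "0 \<le> M"
  shows "(\<Sum>c\<in>A. (wx c / sum wx A - wy c / sum wy A) * g c) \<le> M * \<beta>"
proof -
  let ?X = "sum wx A" and ?Y = "sum wy A"
  have X: "0 < ?X" using Z by linarith
  have "(\<Sum>c\<in>A. (wx c / ?X - wy c / ?Y) * g c) \<le> (\<Sum>c\<in>A. if c \<in> B then M * (wx c / ?X) else 0)"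
  proof (rule sum_mono)
    fix c assume c: "c \<in> A"
    show "(wx c / ?X - wy c / ?Y) * g c \<le> (if c \<in> B then M * (wx c / ?X) else 0)"
    proof (cases "c \<in> B")
      case True
      have "(wx c / ?X - wy c / ?Y) * g c \<le> (wx c / ?X) * g c"
        using c g(1)[OF c] pos(2)[OF c] Z by (intro mult_right_mono) auto
      also have "\<dots> \<le> (wx c / ?X) * M"
        using g(2)[OF c] pos(1)[OF c] X by (intro mult_left_mono) auto
      finally show ?thesis using True by (simp add: mult.commute)
    next
      case False
      have "wx c / ?X \<le> wy c / ?Y"
        using eq[OF c False] pos(2)[OF c] Z by (simp add: frac_le)
      then show ?thesis using False g(1)[OF c] by (simp add: mult_nonpos_nonneg)
    qed
  qed
  also have "\<dots> = (\<Sum>c\<in>A \<inter> B. M * (wx c / ?X))" by (rule sum.inter_restrict[OF fin, symmetric])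
  also have "\<dots> = M * (sum wx (A \<inter> B) / ?X)" by (simp add: sum_distrib_left sum_divide_distrib)
  also have "\<dots> \<le> M * \<beta>" using B X M by (intro mult_left_mono) (auto simp: pos_divide_le_eq)
  finally show ?thesis .
qed

text \<open>Off \<open>B\<close>, the weight with the larger total is the smaller one after normalisation, so only
  its mass on \<open>B\<close> contributes to the total variation distance.\<close>
lemma weighted_average_diff_le:
  fixes wx wy g :: "'a \<Rightarrow> real"
  assumes fin: "finite A" and pos: "\<And>c. c \<in> A \<Longrightarrow> 0 \<le> wx c" "\<And>c. c \<in> A \<Longrightarrow> 0 \<le> wy c"
    and Z: "0 < sum wx A" "0 < sum wy A"
    and eq: "\<And>c. c \<in> A \<Longrightarrow> c \<notin> B \<Longrightarrow> wx c = wy c"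
    and B: "sum wx (A \<inter> B) \<le> \<beta> * sum wx A" "sum wy (A \<inter> B) \<le> \<beta> * sum wy A"
    and g: "\<And>c. c \<in> A \<Longrightarrow> lo \<le> g c" "\<And>c. c \<in> A \<Longrightarrow> g c \<le> lo + M" and M: "0 \<le> M"
  shows "(\<Sum>c\<in>A. (wx c / sum wx A - wy c / sum wy A) * g c) \<le> M * \<beta>"
proof -
  let ?p = "\<lambda>c. wx c / sum wx A" and ?r = "\<lambda>c. wy c / sum wy A"
  have p1: "sum ?p A = 1" using Z(1) by (simp flip: sum_divide_distrib)
  have r1: "sum ?r A = 1" using Z(2) by (simp flip: sum_divide_distrib)
  \<comment> \<open>Both normalised weights sum to 1, so a constant may be subtracted from
    \<open>g\<close>.\<close>
  have shift: "(\<Sum>c\<in>A. (?p c - ?r c) * (g c - t)) = (\<Sum>c\<in>A. (?p c - ?r c) * g c)" for t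
  proof -
    have "(\<Sum>c\<in>A. (?p c - ?r c) * (g c - t)) = (\<Sum>c\<in>A. (?p c - ?r c) * g c) - (\<Sum>c\<in>A. ?p c - ?r c) * t"
      unfolding sum_distrib_right sum_subtractf[symmetric] right_diff_distrib ..
    then show ?thesis using p1 r1 by (simp add: sum_subtractf)
  qed
  show ?thesis
  proof (cases "sum wy A \<le> sum wx A")
    case True
    have "(\<Sum>c\<in>A. (?p c - ?r c) * (g c - lo)) \<le> M * \<beta>"
    proof (rule weighted_average_diff_le_aux[OF fin pos Z(2) True eq B(1)])
      show "g c - lo \<le> M" if "c \<in> A" for c using g(2)[OF that] by simp
    qed (use g M in auto)
    then show ?thesis by (simp only: shift)
  next
    case False
    \<comment> \<open>Exchanging the two weights flips the sign of the difference; reflecting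
      \<open>g\<close> in its range flips it back and keeps the test function nonnegative.\<close>
    have "(\<Sum>c\<in>A. (?r c - ?p c) * (lo + M - g c)) \<le> M * \<beta>"
    proof (rule weighted_average_diff_le_aux[OF fin pos(2,1) Z(1) _ _ B(2)])
      show "wy c = wx c" if "c \<in> A" "c \<notin> B" for c using eq[OF that] by simp
    qed (use g M False in auto)
    moreover have "(\<Sum>c\<in>A. (?r c - ?p c) * (lo + M - g c)) = (\<Sum>c\<in>A. (?p c - ?r c) * (g c - (lo + M)))"
      by (rule sum.cong, rule refl, algebra)
    ultimately show ?thesis by (simp only: shift)
  qed
qed

lemma sum_bex_le:
  fixes W :: "'a \<Rightarrow> real"
  assumes "finite A" "finite I" "\<And>c. c \<in> A \<Longrightarrow> 0 \<le> W c"
  shows "(\<Sum>c | c \<in> A \<and> (\<exists>i\<in>I. Q i c). W c) \<le> (\<Sum>i\<in>I. \<Sum>c | c \<in> A \<and> Q i c. W c)"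
  using assms(2)
proof induction
  case (insert i I)
  let ?P = "{c. c \<in> A \<and> Q i c}" and ?R = "{c. c \<in> A \<and> (\<exists>i\<in>I. Q i c)}"
  have "{c. c \<in> A \<and> (\<exists>i\<in>insert i I. Q i c)} = ?P \<union> ?R" by blast
  moreover have "sum W (?P \<union> ?R) = sum W ?P + sum W ?R - sum W (?P \<inter> ?R)"
    using assms(1) by (intro sum_Un) auto
  moreover have "0 \<le> sum W (?P \<inter> ?R)" using assms(3) by (intro sum_nonneg) auto
  ultimately show ?case using insert by simp
qed simp

section \<open>Lipschitz functions for the Hamming distance and averages over block updates\<close>

context potts
begin

definition hamming :: "('v \<Rightarrow> nat) \<Rightarrow> ('v \<Rightarrow> nat) \<Rightarrow> nat" where
  "hamming x y = card {v \<in> V. x v \<noteq> y v}"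

text \<open>The one-sided inequality bounds the absolute difference, because \<open>x\<close> and
  \<open>y\<close> may be exchanged.\<close>

definition lipschitz :: "real \<Rightarrow> (('v \<Rightarrow> nat) \<Rightarrow> real) \<Rightarrow> bool" where
  "lipschitz L f \<longleftrightarrow> (\<forall>x\<in>configs V q. \<forall>y\<in>configs V q. f x - f y \<le> L * real (hamming x y))"

lemma hamming_le: "T \<subseteq> V \<Longrightarrow> (\<And>v. v \<in> V \<Longrightarrow> v \<notin> T \<Longrightarrow> x v = y v) \<Longrightarrow> hamming x y \<le> card T"
  unfolding hamming_def using finV finite_subset by (intro card_mono) auto

text \<open>The path step of path coupling: recolouring one vertex of disagreement at a time joins
  \<open>x\<close> to \<open>y\<close> in \<open>hamming x y\<close> moves that stay inside
  \<open>configs V q\<close>.\<close>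

lemma lipschitz_from_neighbours:
  assumes nb: "\<And>x y v. \<lbrakk>x \<in> configs V q; y \<in> configs V q; v \<in> V; x v \<noteq> y v; \<And>u. u \<noteq> v \<Longrightarrow> x u = y u\<rbrakk>
    \<Longrightarrow> f x - f y \<le> L"
  shows "lipschitz L f"
proof -
  have "f x - f y \<le> L * real n"
    if "x \<in> configs V q" "y \<in> configs V q" "hamming x y = n" for x y n
    using that
  proof (induction n arbitrary: x)
    case 0
    then have "{v \<in> V. x v \<noteq> y v} = {}" using finV by (simp add: hamming_def)
    then have "x v = y v" for v using 0 by (cases "v \<in> V") (auto simp: configs_def)
    then have "x = y" by (rule ext)
    then show ?case by simp
  next
    case (Suc n)
    then have "card {v \<in> V. x v \<noteq> y v} \<noteq> 0" by (simp add: hamming_def)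
    then have "{v \<in> V. x v \<noteq> y v} \<noteq> {}" by (metis card.empty)
    then obtain v where v: "v \<in> V" "x v \<noteq> y v" by blast
    let ?z = "x(v := y v)"
    have z: "?z \<in> configs V q" using Suc.prems v by (auto simp: configs_def)
    have "{u \<in> V. ?z u \<noteq> y u} = {u \<in> V. x u \<noteq> y u} - {v}" by auto
    then have "hamming ?z y = n"
      using Suc.prems(3) v finV by (simp add: hamming_def)
    then have "f ?z - f y \<le> L * real n" by (rule Suc.IH[OF z Suc.prems(2)])
    moreover have "f x - f ?z \<le> L" by (rule nb[OF Suc.prems(1) z v(1)]) (use v in auto)
    ultimately show ?case by (simp add: algebra_simps)
  qed
  then show ?thesis by (auto simp: lipschitz_def)
qed

text \<open>The expectation of \<open>f\<close> after an update of \<open>S\<close>. Summing over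
  colourings instead of resulting configurations allows two updates to be compared colouring by
  colouring.\<close>

definition block_avg :: "('v \<Rightarrow> nat) \<Rightarrow> 'v set \<Rightarrow> (('v \<Rightarrow> nat) \<Rightarrow> real) \<Rightarrow> real" where
  "block_avg X S f =
     (\<Sum>c\<in>block_colourings S q. block_weight X S c / block_Z X S * f (upd_block X S c))"

lemma upd_block_configs:
  "\<lbrakk>X \<in> configs V q; S \<subseteq> V; c \<in> block_colourings S q\<rbrakk> \<Longrightarrow> upd_block X S c \<in> configs V q"
  by (auto simp: configs_def block_colourings_def upd_block_def)

lemma finite_configs: "finite (configs V q)"
  unfolding configs_eq_block_colourings by (rule finite_block_colourings[OF finV])

lemma sum_block_step:
  assumes "X \<in> configs V q" "S \<subseteq> V"
  shows "(\<Sum>Y\<in>configs V q. block_step V adj q lam S X Y * f Y) = block_avg X S f"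
proof -
  have fin: "finite (block_colourings S q)"
    using finite_block_colourings[OF finite_subset[OF assms(2) finV]] .
  have "(\<Sum>Y\<in>configs V q. block_step V adj q lam S X Y * f Y)
      = (\<Sum>Y\<in>configs V q. \<Sum>c\<in>{c \<in> block_colourings S q. upd_block X S c = Y}.
           block_weight X S c / block_Z X S * f (upd_block X S c))"
    unfolding block_step_def block_Z_def[symmetric]
    by (rule sum.cong) (auto simp: sum_divide_distrib sum_distrib_right)
  also have "\<dots> = block_avg X S f"
    unfolding block_avg_def using upd_block_configs[OF assms]
    by (intro sum.group fin finite_configs) auto
  finally show ?thesis .
qed

text \<open>An edge that meets \<open>S\<close> and contains \<open>v\<close> joins \<open>v\<close>
  to some \<open>z\<close> in \<open>S\<close>, and it is monochromatic in neither configuration. No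
  other edge sees the difference at \<open>v\<close>.\<close>

lemma mu_block_eq:
  assumes xy: "\<And>u. u \<noteq> v \<Longrightarrow> x u = y u" and v: "v \<notin> S"
    and c: "\<And>z. z \<in> S \<Longrightarrow> adj v z \<Longrightarrow> c z \<noteq> x v \<and> c z \<noteq> y v"
  shows "mu_block V adj x S c = mu_block V adj y S c"
proof -
  have "e \<in> mono_edges V adj (upd_block x S c) \<longleftrightarrow> e \<in> mono_edges V adj (upd_block y S c)"
    if e: "e \<inter> S \<noteq> {}" "e \<in> edges V adj" for e
  proof (cases "v \<in> e")
    case True
    then obtain z where z: "e = {v, z}" using e by (auto simp: edges_def)
    then have zS: "z \<in> S" using e v by auto
    moreover have "adj v z" using e(2) z edges_doubleton[OF G] by simp
    ultimately have "c z \<noteq> x v" "c z \<noteq> y v" using c by auto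
    then show ?thesis using zS v unfolding z mono_edges_doubleton upd_block_def by auto
  next
    case False
    obtain a b where ab: "e = {a, b}" using e(2) by (auto simp: edges_def)
    then have "x a = y a" "x b = y b" using xy[of a] xy[of b] False by auto
    then show ?thesis unfolding ab mono_edges_doubleton upd_block_def by simp
  qed
  moreover have "mono_edges V adj \<sigma> \<subseteq> edges V adj" for \<sigma> unfolding mono_edges_def by blast
  ultimately have "{e \<in> mono_edges V adj (upd_block x S c). e \<inter> S \<noteq> {}}
      = {e \<in> mono_edges V adj (upd_block y S c). e \<inter> S \<noteq> {}}" by blast
  then show ?thesis by (simp add: mu_block_def)
qed

lemma block_avg_cong:
  assumes "\<And>u. u \<notin> S \<Longrightarrow> x u = y u"
  shows "block_avg x S f = block_avg y S f"
proof -
  have "upd_block x S = upd_block y S" using assms by (auto simp: upd_block_def fun_eq_iff)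
  then show ?thesis by (simp add: block_avg_def block_Z_def mu_block_def)
qed

text \<open>The difference splits in two. Inserting the same colouring into \<open>x\<close> and
  \<open>y\<close> leaves only the discrepancy at \<open>v\<close>, which costs \<open>L\<close>.
  Changing the distribution of the colouring costs the oscillation of \<open>f\<close> over updates
  of \<open>S\<close>, at most \<open>L * card S\<close>, times the mass of the colourings on which
  the weights can differ.\<close>

lemma block_avg_diff_le:
  assumes x: "x \<in> configs V q" and y: "y \<in> configs V q" and v: "v \<in> V" "v \<notin> S"
    and xy: "\<And>u. u \<noteq> v \<Longrightarrow> x u = y u"
    and S: "S \<subseteq> V" "induced_connected adj S" "S \<noteq> {}"
    and \<rho>: "0 < \<rho>" "\<rho> \<le> 1" "lam ^ (max_degree V adj - 1) \<le> \<rho> * real q"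
      "lam ^ (card S * (max_degree V adj - 1) + 1) \<le> (\<rho> * real q) ^ card S"
    and f: "lipschitz L f" "0 \<le> L"
  shows "block_avg x S f - block_avg y S f
    \<le> L + L * real (card S) * (real (card {z \<in> S. adj v z}) * 2 ^ card S * \<rho>)"
proof -
  let ?A = "block_colourings S q"
  let ?N = "{z \<in> S. adj v z}"
  let ?p = "\<lambda>c. block_weight x S c / block_Z x S" and ?r = "\<lambda>c. block_weight y S c / block_Z y S"
  let ?g = "\<lambda>c. f (upd_block y S c)"
  \<comment> \<open>Union bound over the neighbours of \<open>v\<close> in \<open>S\<close> and the
    two colours of \<open>v\<close>; the factor 2 turns \<open>2 ^ (card S - 1)\<close> into
    \<open>2 ^ card S\<close>.\<close>
  let ?\<beta> = "real (card ?N) * 2 ^ card S * \<rho>"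
  let ?I = "?N \<times> {x v, y v}"
  let ?B = "{c. \<exists>i\<in>?I. c (fst i) = snd i}"
  have finS: "finite S" using finite_subset[OF S(1) finV] .
  have finA: "finite ?A" using finite_block_colourings[OF finS] .
  have finI: "finite ?I" using finS by simp
  have cS: "0 < card S" using S finS by (simp add: card_gt_0_iff)
  have W: "0 \<le> block_weight X S c" for X c using lam_ge by simp
  have mass: "(\<Sum>c\<in>?A \<inter> ?B. block_weight X S c) \<le> ?\<beta> * (\<Sum>c\<in>?A. block_weight X S c)" for X
  proof -
    have "(\<Sum>c\<in>?A \<inter> ?B. block_weight X S c) = (\<Sum>c | c \<in> ?A \<and> (\<exists>i\<in>?I. c (fst i) = snd i). block_weight X S c)"
      by (rule sum.cong) auto
    also have "\<dots> \<le> (\<Sum>i\<in>?I. \<Sum>c | c \<in> ?A \<and> c (fst i) = snd i. block_weight X S c)"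
      by (rule sum_bex_le[OF finA finI W])
    also have "\<dots> \<le> (\<Sum>i\<in>?I. 2 ^ (card S - 1) * \<rho> * block_Z X S)"
      by (intro sum_mono sum_weight_colour_le[OF S(1,2) _ \<rho>]) auto
    also have "\<dots> = real (card ?I) * (2 ^ (card S - 1) * \<rho> * block_Z X S)" by simp
    also have "\<dots> \<le> real (card ?N * 2) * (2 ^ (card S - 1) * \<rho> * block_Z X S)"
    proof (rule mult_right_mono)
      have "card ?I \<le> card ?N * 2"
        unfolding card_cartesian_product by (intro mult_le_mono2) (simp add: card_insert_if)
      then show "real (card ?I) \<le> real (card ?N * 2)" by (rule of_nat_mono)
      show "0 \<le> 2 ^ (card S - 1) * \<rho> * block_Z X S" using \<rho> block_Z_pos[OF S(1), of X] by simp
    qed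
    also have "\<dots> = real (card ?N) * (2 * 2 ^ (card S - 1)) * \<rho> * block_Z X S" by simp
    also have "(2 :: real) * 2 ^ (card S - 1) = 2 ^ card S" using cS by (cases "card S") auto
    finally show ?thesis by (simp add: block_Z_def)
  qed
  have upd: "upd_block X S c \<in> configs V q" if "X \<in> configs V q" "c \<in> ?A" for X c
    using upd_block_configs that S by blast
  have gdiff: "?g c - ?g d \<le> L * real (card S)" if "c \<in> ?A" "d \<in> ?A" for c d
  proof -
    have "?g c - ?g d \<le> L * real (hamming (upd_block y S c) (upd_block y S d))"
      using f upd[OF y] that by (simp add: lipschitz_def)
    also have "\<dots> \<le> L * real (card S)"
    proof (rule mult_left_mono[OF of_nat_mono f(2)])
      show "hamming (upd_block y S c) (upd_block y S d) \<le> card S"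
        by (rule hamming_le[OF S(1)]) (simp add: upd_block_def)
    qed
    finally show ?thesis .
  qed
  define lo where "lo = Min (?g ` ?A)"
  have lo_le: "lo \<le> ?g c" if "c \<in> ?A" for c
    unfolding lo_def using finA that by (intro Min_le) auto
  have "lo \<in> ?g ` ?A"
    unfolding lo_def using finA zero_block_colouring[of S] by (intro Min_in) auto
  then have lo_ge: "?g c \<le> lo + L * real (card S)" if "c \<in> ?A" for c
    using gdiff[OF that] by (auto simp: algebra_simps)
  have part2: "(\<Sum>c\<in>?A. (?p c - ?r c) * ?g c) \<le> L * real (card S) * ?\<beta>"
    unfolding block_Z_def
  proof (rule weighted_average_diff_le[OF finA W W _ _ _ mass mass lo_le lo_ge])
    show "block_weight x S c = block_weight y S c" if "c \<in> ?A" "c \<notin> ?B" for c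
    proof -
      have "c z \<noteq> x v \<and> c z \<noteq> y v" if "z \<in> S" "adj v z" for z
        using \<open>c \<notin> ?B\<close> that by auto
      then have "mu_block V adj x S c = mu_block V adj y S c"
        by (intro mu_block_eq[of v] xy v) auto
      then show ?thesis by simp
    qed
  qed (use block_Z_pos[OF S(1)] f(2) in \<open>auto simp: block_Z_def\<close>)
  have part1: "(\<Sum>c\<in>?A. ?p c * (f (upd_block x S c) - ?g c)) \<le> L"
  proof -
    have "(\<Sum>c\<in>?A. ?p c * (f (upd_block x S c) - ?g c)) \<le> (\<Sum>c\<in>?A. ?p c * L)"
    proof (intro sum_mono mult_left_mono)
      fix c assume c: "c \<in> ?A"
      have "f (upd_block x S c) - ?g c \<le> L * real (hamming (upd_block x S c) (upd_block y S c))"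
        using f upd[OF x] upd[OF y] c by (simp add: lipschitz_def)
      also have "\<dots> \<le> L * real (card {v})"
      proof (rule mult_left_mono[OF of_nat_mono f(2)])
        show "hamming (upd_block x S c) (upd_block y S c) \<le> card {v}"
          by (rule hamming_le) (use v xy in \<open>auto simp: upd_block_def\<close>)
      qed
      finally show "f (upd_block x S c) - ?g c \<le> L" by simp
      show "0 \<le> ?p c" using W block_Z_pos[OF S(1), of x] by (intro divide_nonneg_pos) auto
    qed
    also have "\<dots> = L"
      using block_Z_pos[OF S(1), of x]
      by (simp add: block_Z_def flip: sum_distrib_right sum_divide_distrib)
    finally show ?thesis .
  qed
  have "block_avg x S f - block_avg y S f
      = (\<Sum>c\<in>?A. ?p c * (f (upd_block x S c) - ?g c)) + (\<Sum>c\<in>?A. (?p c - ?r c) * ?g c)"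
    unfolding block_avg_def sum.distrib[symmetric] sum_subtractf[symmetric]
    by (rule sum.cong, rule refl, algebra)
  then show ?thesis using part1 part2 by linarith
qed

end

section \<open>Contraction and stationarity\<close>

text \<open>Half the sign of the difference is a test function that attains the total variation
  distance. By stationarity its mean under \<pi> is the \<pi>-average of its means after
  \<open>t\<close> steps from all starting states, so comparing pairs of starting states is
  enough.\<close>

lemma tv_dist_mpow_le:
  fixes P :: "'s \<Rightarrow> 's \<Rightarrow> real"
  assumes stat: "\<And>y. y \<in> \<Omega> \<Longrightarrow> (\<Sum>x\<in>\<Omega>. \<pi> x * P x y) = \<pi> y"
    and \<pi>: "\<And>x. x \<in> \<Omega> \<Longrightarrow> 0 \<le> \<pi> x" "sum \<pi> \<Omega> = 1" and fin: "finite \<Omega>" and x: "x \<in> \<Omega>"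
    and osc: "\<And>f y. \<lbrakk>y \<in> \<Omega>; \<And>z. \<bar>f z\<bar> \<le> 1 / 2\<rbrakk>
      \<Longrightarrow> (\<Sum>z\<in>\<Omega>. mpow \<Omega> P t x z * f z) - (\<Sum>z\<in>\<Omega>. mpow \<Omega> P t y z * f z) \<le> r"
  shows "tv_dist \<Omega> (mpow \<Omega> P t x) \<pi> \<le> r"
proof -
  define f where "f z = sgn (mpow \<Omega> P t x z - \<pi> z) / 2" for z
  let ?F = "\<lambda>y. \<Sum>z\<in>\<Omega>. mpow \<Omega> P t y z * f z"
  have stat_t: "(\<Sum>y\<in>\<Omega>. \<pi> y * mpow \<Omega> P t y z) = \<pi> z" if "z \<in> \<Omega>" for z
    using that
  proof (induction t arbitrary: z)
    case 0
    then show ?case using fin by (simp add: if_distrib cong: if_cong)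
  next
    case (Suc t)
    have "(\<Sum>y\<in>\<Omega>. \<pi> y * mpow \<Omega> P (Suc t) y z)
        = (\<Sum>w\<in>\<Omega>. (\<Sum>y\<in>\<Omega>. \<pi> y * mpow \<Omega> P t y w) * P w z)"
      unfolding mpow.simps sum_distrib_left sum_distrib_right mult.assoc[symmetric] by (rule sum.swap)
    also have "\<dots> = (\<Sum>w\<in>\<Omega>. \<pi> w * P w z)" using Suc.IH by simp
    finally show ?case using stat Suc.prems by simp
  qed
  have "tv_dist \<Omega> (mpow \<Omega> P t x) \<pi> = (\<Sum>z\<in>\<Omega>. (mpow \<Omega> P t x z - \<pi> z) * f z)"
    unfolding tv_dist_def f_def sum_divide_distrib
    by (rule sum.cong) (simp_all add: abs_sgn)
  also have "\<dots> = ?F x - (\<Sum>z\<in>\<Omega>. \<pi> z * f z)"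
    by (simp add: left_diff_distrib sum_subtractf)
  also have "(\<Sum>z\<in>\<Omega>. \<pi> z * f z) = (\<Sum>z\<in>\<Omega>. (\<Sum>y\<in>\<Omega>. \<pi> y * mpow \<Omega> P t y z) * f z)"
    by (rule sum.cong) (simp_all add: stat_t)
  also have "\<dots> = (\<Sum>y\<in>\<Omega>. \<pi> y * ?F y)"
    unfolding sum_distrib_left sum_distrib_right mult.assoc[symmetric] by (rule sum.swap)
  also have "?F x - \<dots> = (\<Sum>y\<in>\<Omega>. \<pi> y * (?F x - ?F y))"
    unfolding right_diff_distrib sum_subtractf sum_distrib_right[symmetric] \<pi>(2) by simp
  also have "\<dots> \<le> (\<Sum>y\<in>\<Omega>. \<pi> y * r)"
    by (intro sum_mono mult_left_mono osc \<pi>) (auto simp: f_def sgn_if)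
  also have "\<dots> = r" unfolding sum_distrib_right[symmetric] \<pi>(2) by simp
  finally show ?thesis .
qed

section \<open>Stationarity of the Gibbs distribution and contraction of the chain\<close>

context potts
begin

lemma block_avg_const: "S \<subseteq> V \<Longrightarrow> block_avg X S (\<lambda>_. 1) = 1"
  unfolding block_avg_def using block_Z_pos[of S X]
  by (simp add: block_Z_def flip: sum_divide_distrib)

text \<open>Detailed balance. If \<open>x\<close> and \<open>y\<close> agree off \<open>S\<close>,
  they share the normalising constant and the monochromatic edges that avoid \<open>S\<close>; the
  edges meeting \<open>S\<close> enter once through the Gibbs weight and once through the
  transition. Otherwise both transitions have probability 0.\<close>

lemma block_step_reversible:
  assumes x: "x \<in> configs V q" and y: "y \<in> configs V q" and S: "S \<subseteq> V"
  shows "lam ^ mu V adj x * block_step V adj q lam S x y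
    = lam ^ mu V adj y * block_step V adj q lam S y x"
proof (cases "\<forall>u. u \<notin> S \<longrightarrow> x u = y u")
  case True
  have upd: "upd_block x S = upd_block y S" using True by (auto simp: upd_block_def fun_eq_iff)
  have single: "block_step V adj q lam S z w = lam ^ card {e \<in> mono_edges V adj w. e \<inter> S \<noteq> {}} / block_Z z S"
    if zw: "w \<in> configs V q" "\<And>u. u \<notin> S \<Longrightarrow> z u = w u" for z w
  proof -
    let ?c = "\<lambda>u. if u \<in> S then w u else 0"
    have upd_c: "upd_block z S ?c = w" using zw(2) by (auto simp: upd_block_def fun_eq_iff)
    \<comment> \<open>The restriction of \<open>w\<close> is the only colouring that leads from
      \<open>z\<close> to \<open>w\<close>, so the numerator of \<open>block_step\<close> is a
      single power.\<close>
    have "{c \<in> block_colourings S q. upd_block z S c = w} = {?c}"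
    proof (intro equalityI subsetI)
      fix c assume "c \<in> {c \<in> block_colourings S q. upd_block z S c = w}"
      then have c: "c \<in> block_colourings S q" "upd_block z S c = w" by auto
      have "c u = ?c u" for u
        using c(1) fun_cong[OF c(2), of u] by (cases "u \<in> S") (auto simp: upd_block_def block_colourings_def)
      then show "c \<in> {?c}" by auto
    next
      fix c assume "c \<in> {?c}"
      then have c: "c = ?c" by simp
      have "?c \<in> block_colourings S q" using zw(1) S by (auto simp: block_colourings_def configs_def)
      then show "c \<in> {c \<in> block_colourings S q. upd_block z S c = w}"
        unfolding c using upd_c by blast
    qed
    then show ?thesis by (simp add: block_step_def block_Z_def mu_block_def upd_c)
  qed
  have mu_split: "mu V adj z = card {e \<in> mono_edges V adj z. e \<inter> S \<noteq> {}}
      + card {e \<in> mono_edges V adj z. e \<inter> S = {}}" for z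
  proof -
    have "mono_edges V adj z = {e \<in> mono_edges V adj z. e \<inter> S \<noteq> {}} \<union> {e \<in> mono_edges V adj z. e \<inter> S = {}}"
      by blast
    then show ?thesis
      unfolding mu_def using finite_mono_edges[of z]
      by (subst card_Un_disjoint[symmetric]) auto
  qed
  have off: "{e \<in> mono_edges V adj x. e \<inter> S = {}} = {e \<in> mono_edges V adj y. e \<inter> S = {}}"
    by (rule mono_edges_avoiding_cong) (use True in auto)
  have Z: "block_Z x S = block_Z y S" by (simp add: block_Z_def mu_block_def upd)
  show ?thesis
    using single[OF y, of x] single[OF x, of y] True
    by (simp add: mu_split[of x] mu_split[of y] off Z power_add)
next
  case False
  then obtain u where u: "u \<notin> S" "x u \<noteq> y u" by blast
  have "{c \<in> block_colourings S q. upd_block x S c = y} = {}"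
    "{c \<in> block_colourings S q. upd_block y S c = x} = {}"
    using u by (auto simp: upd_block_def)
  then show ?thesis by (simp only: block_step_def sum.empty div_0 mult_zero_right)
qed

lemma gibbs_stationary:
  assumes Sb: "\<And>v. v \<in> V \<Longrightarrow> Sb v \<subseteq> V" and V: "V \<noteq> {}" and y: "y \<in> configs V q"
  shows "(\<Sum>x\<in>configs V q. gibbs V adj q lam x * block_dynamics V adj q lam Sb x y) = gibbs V adj q lam y"
proof -
  let ?n = "real (card V)"
  have rev: "gibbs V adj q lam x * block_dynamics V adj q lam Sb x y
      = gibbs V adj q lam y * block_dynamics V adj q lam Sb y x" if x: "x \<in> configs V q" for x
  proof -
    have "(\<Sum>v\<in>V. lam ^ mu V adj x * block_step V adj q lam (Sb v) x y)
        = (\<Sum>v\<in>V. lam ^ mu V adj y * block_step V adj q lam (Sb v) y x)"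
      by (intro sum.cong refl block_step_reversible x y Sb)
    then show ?thesis
      unfolding gibbs_def block_dynamics_def
      by (simp add: sum_distrib_left[symmetric] times_divide_times_eq)
  qed
  have row: "(\<Sum>x\<in>configs V q. block_dynamics V adj q lam Sb y x) = 1"
  proof -
    have "(\<Sum>x\<in>configs V q. block_dynamics V adj q lam Sb y x)
        = (\<Sum>v\<in>V. \<Sum>x\<in>configs V q. block_step V adj q lam (Sb v) y x * 1) / ?n"
      unfolding block_dynamics_def sum_divide_distrib[symmetric]
      by (subst sum.swap) simp
    also have "\<dots> = (\<Sum>v\<in>V. 1) / ?n"
      using sum_block_step[OF y Sb, of _ "\<lambda>_. 1"] block_avg_const[OF Sb] by simp
    finally show ?thesis using V finV by simp
  qed
  have "(\<Sum>x\<in>configs V q. gibbs V adj q lam x * block_dynamics V adj q lam Sb x y)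
      = (\<Sum>x\<in>configs V q. gibbs V adj q lam y * block_dynamics V adj q lam Sb y x)"
    by (intro sum.cong refl rev)
  then show ?thesis using row by (simp add: sum_distrib_left[symmetric])
qed

text \<open>For neighbouring configurations the block of \<open>v\<close> itself contributes 0 and
  every other block at most \<open>L\<close>. Blocks adjacent to \<open>v\<close> may add an excess,
  and the number of these blocks times the excess is at most \<open>L * \<delta>\<close> by
  \<open>small\<close>.\<close>

lemma block_dynamics_contracts:
  assumes B: "block_system V adj k Sb"
    and \<rho>: "0 < \<rho>" "\<rho> \<le> 1" "lam ^ (max_degree V adj - 1) \<le> \<rho> * real q"
      "lam ^ (k * (max_degree V adj - 1) + 1) \<le> (\<rho> * real q) ^ k"
    and small: "(1 + real (max_degree V adj)) ^ k * (real k * (real k * 2 ^ k * \<rho>)) \<le> \<delta>"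
    and f: "lipschitz L f" "0 \<le> L"
  shows "lipschitz (L * (1 - (1 - \<delta>) / real (card V)))
    (\<lambda>x. \<Sum>y\<in>configs V q. block_dynamics V adj q lam Sb x y * f y)"
proof (rule lipschitz_from_neighbours)
  let ?P = "\<lambda>x. \<Sum>y\<in>configs V q. block_dynamics V adj q lam Sb x y * f y"
  fix x y v assume x: "x \<in> configs V q" and y: "y \<in> configs V q" and v: "v \<in> V"
    and xy: "\<And>u. u \<noteq> v \<Longrightarrow> x u = y u"
  let ?n = "real (card V)"
  have n: "0 < card V" using v finV by (auto simp: card_gt_0_iff)
  have S: "u \<in> Sb u" "Sb u \<subseteq> V" "card (Sb u) = k" "induced_connected adj (Sb u)" if "u \<in> V" for u
    using B that by (auto simp: block_system_def)
  let ?K = "{u \<in> V. v \<notin> Sb u \<and> (\<exists>z\<in>Sb u. adj v z)}"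
  let ?e = "L * real k * (real k * 2 ^ k * \<rho>)"
  have e0: "0 \<le> ?e" using f \<rho> by simp
  have P: "?P z = (\<Sum>u\<in>V. block_avg z (Sb u) f) / ?n" if "z \<in> configs V q" for z
  proof -
    have "?P z = (\<Sum>u\<in>V. \<Sum>y\<in>configs V q. block_step V adj q lam (Sb u) z y * f y) / ?n"
      unfolding block_dynamics_def
      by (subst sum.swap) (simp add: sum_divide_distrib[symmetric] sum_distrib_right[symmetric])
    also have "(\<Sum>u\<in>V. \<Sum>y\<in>configs V q. block_step V adj q lam (Sb u) z y * f y)
        = (\<Sum>u\<in>V. block_avg z (Sb u) f)"
      by (intro sum.cong refl sum_block_step that S)
    finally show ?thesis .
  qed
  have each: "block_avg x (Sb u) f - block_avg y (Sb u) f
      \<le> (if u = v then 0 else L) + (if u \<in> ?K then ?e else 0)" if u: "u \<in> V" for u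
  proof (cases "v \<in> Sb u")
    case True
    then have "block_avg x (Sb u) f = block_avg y (Sb u) f"
      by (intro block_avg_cong xy) auto
    then show ?thesis using True f by simp
  next
    case False
    then have uv: "u \<noteq> v" using S(1)[OF u] by auto
    let ?N = "{z \<in> Sb u. adj v z}"
    have finS: "finite (Sb u)" using finite_subset[OF S(2)[OF u] finV] .
    have "block_avg x (Sb u) f - block_avg y (Sb u) f
        \<le> L + L * real (card (Sb u)) * (real (card ?N) * 2 ^ card (Sb u) * \<rho>)"
      by (rule block_avg_diff_le[OF x y v False xy S(2,4)[OF u]])
         (use S[OF u] \<rho> f in auto)
    also have "\<dots> = L + L * real k * (real (card ?N) * 2 ^ k * \<rho>)" using S(3)[OF u] by simp
    also have "L * real k * (real (card ?N) * 2 ^ k * \<rho>) \<le> (if u \<in> ?K then ?e else 0)"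
    proof (cases "u \<in> ?K")
      case True
      have "card ?N \<le> k" using card_mono[OF finS, of ?N] S(3)[OF u] by auto
      then have "L * real k * (real (card ?N) * 2 ^ k * \<rho>) \<le> ?e"
        using f \<rho> by (intro mult_left_mono mult_right_mono) auto
      then show ?thesis using True by simp
    next
      case no: False
      \<comment> \<open>A block neither containing nor adjacent to \<open>v\<close> has no vertex
        where the update could notice the discrepancy.\<close>
      then have "?N = {}" using u False by auto
      then have N: "card ?N = 0" by (simp only: card.empty)
      show ?thesis unfolding N if_not_P[OF no] by simp
    qed
    finally show ?thesis using uv by simp
  qed
  have "real (card ?K) \<le> (1 + real (max_degree V adj)) ^ k"
    using of_nat_mono[OF card_adjacent_blocks_le[OF G B v], where 'a = real] by simp
  then have "real (card ?K) * ?e \<le> (1 + real (max_degree V adj)) ^ k * ?e"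
    using e0 by (rule mult_right_mono)
  also have "\<dots> = L * ((1 + real (max_degree V adj)) ^ k * (real k * (real k * 2 ^ k * \<rho>)))"
    by (simp add: mult_ac)
  also have "\<dots> \<le> L * \<delta>" using small f(2) by (rule mult_left_mono)
  finally have K: "real (card ?K) * ?e \<le> L * \<delta>" .
  have "(\<Sum>u\<in>V. block_avg x (Sb u) f) - (\<Sum>u\<in>V. block_avg y (Sb u) f)
      = (\<Sum>u\<in>V. block_avg x (Sb u) f - block_avg y (Sb u) f)" by (simp add: sum_subtractf)
  also have "\<dots> \<le> (\<Sum>u\<in>V. (if u = v then 0 else L) + (if u \<in> ?K then ?e else 0))"
    by (rule sum_mono[OF each])
  also have "\<dots> = (\<Sum>u\<in>V. if u = v then 0 else L) + (\<Sum>u\<in>V. if u \<in> ?K then ?e else 0)"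
    by (rule sum.distrib)
  also have "(\<Sum>u\<in>V. if u = v then 0 else L) = (?n - 1) * L"
  proof -
    have "(\<Sum>u\<in>V. if u = v then 0 else L) = (\<Sum>u\<in>V - {v}. L)"
      using finV v by (simp add: sum.remove[of V v])
    also have "\<dots> = (?n - 1) * L" using finV v n by (simp add: of_nat_diff)
    finally show ?thesis .
  qed
  also have "(\<Sum>u\<in>V. if u \<in> ?K then ?e else 0) = real (card ?K) * ?e"
  proof -
    have "(\<Sum>u\<in>V. if u \<in> ?K then ?e else 0) = (\<Sum>u\<in>V \<inter> ?K. ?e)"
      by (rule sum.inter_restrict[OF finV, symmetric])
    also have "V \<inter> ?K = ?K" by blast
    finally show ?thesis by simp
  qed
  finally have D: "(\<Sum>u\<in>V. block_avg x (Sb u) f) - (\<Sum>u\<in>V. block_avg y (Sb u) f)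
      \<le> (?n - 1) * L + L * \<delta>" using K by linarith
  have "?P x - ?P y = ((\<Sum>u\<in>V. block_avg x (Sb u) f) - (\<Sum>u\<in>V. block_avg y (Sb u) f)) / ?n"
    by (simp add: P[OF x] P[OF y] diff_divide_distrib)
  also have "\<dots> \<le> ((?n - 1) * L + L * \<delta>) / ?n"
    using D n by (intro divide_right_mono) auto
  also have "\<dots> = L * (1 - (1 - \<delta>) / ?n)" using n by (simp add: field_simps)
  finally show "?P x - ?P y \<le> L * (1 - (1 - \<delta>) / ?n)" .
qed

text \<open>\<open>mpow\<close> appends the new step on the right, so the step acts on
  \<open>f\<close> first and the induction hypothesis is applied to the averaged function; hence
  \<open>L\<close> and \<open>f\<close> vary in the induction.\<close>

lemma lipschitz_mpow:
  assumes step: "\<And>L f. \<lbrakk>lipschitz L f; 0 \<le> L\<rbrakk> \<Longrightarrow> lipschitz (L * \<alpha>) (\<lambda>x. \<Sum>y\<in>configs V q. P x y * f y)"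
    and "0 \<le> \<alpha>" "lipschitz L f" "0 \<le> L"
  shows "lipschitz (L * \<alpha> ^ t) (\<lambda>x. \<Sum>y\<in>configs V q. mpow (configs V q) P t x y * f y)"
  using assms(3,4)
proof (induction t arbitrary: L f)
  case 0
  have "(\<Sum>y\<in>configs V q. mpow (configs V q) P 0 x y * f y) = f x" if "x \<in> configs V q" for x
    using that finite_configs by (simp add: if_distrib[of "\<lambda>a. a * _"] cong: if_cong)
  then show ?case using 0 by (simp add: lipschitz_def)
next
  case (Suc t)
  let ?\<Omega> = "configs V q"
  have "(\<Sum>y\<in>?\<Omega>. mpow ?\<Omega> P (Suc t) x y * f y)
      = (\<Sum>z\<in>?\<Omega>. mpow ?\<Omega> P t x z * (\<Sum>y\<in>?\<Omega>. P z y * f y))" for x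
    unfolding mpow.simps sum_distrib_left sum_distrib_right mult.assoc[symmetric] by (rule sum.swap)
  moreover have "lipschitz (L * \<alpha> * \<alpha> ^ t) (\<lambda>x. \<Sum>z\<in>?\<Omega>. mpow ?\<Omega> P t x z * (\<Sum>y\<in>?\<Omega>. P z y * f y))"
    using Suc assms(2) by (intro Suc.IH step) auto
  ultimately show ?case by (simp add: mult.assoc)
qed

text \<open>A function bounded by 1/2 oscillates by at most 1, so it has Lipschitz constant 1; the
  Hamming diameter supplies the factor \<open>card V\<close>.\<close>

lemma tv_dist_contracting_le:
  assumes step: "\<And>L f. \<lbrakk>lipschitz L f; 0 \<le> L\<rbrakk> \<Longrightarrow> lipschitz (L * \<alpha>) (\<lambda>x. \<Sum>y\<in>configs V q. P x y * f y)"
    and \<alpha>: "0 \<le> \<alpha>"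
    and stat: "\<And>y. y \<in> configs V q \<Longrightarrow> (\<Sum>x\<in>configs V q. gibbs V adj q lam x * P x y) = gibbs V adj q lam y"
    and x: "x \<in> configs V q"
  shows "tv_dist (configs V q) (mpow (configs V q) P t x) (gibbs V adj q lam) \<le> real (card V) * \<alpha> ^ t"
proof (rule tv_dist_mpow_le[OF stat _ _ finite_configs x])
  let ?\<Omega> = "configs V q"
  let ?Z = "\<Sum>\<tau>\<in>configs V q. lam ^ mu V adj \<tau>"
  have Z: "0 < ?Z" using finite_configs x lam_ge by (intro sum_pos) auto
  show "0 \<le> gibbs V adj q lam z" for z
    unfolding gibbs_def using Z lam_ge by (intro divide_nonneg_pos) auto
  show "sum (gibbs V adj q lam) ?\<Omega> = 1"
    unfolding gibbs_def using Z by (simp flip: sum_divide_distrib)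
  fix f :: "('v \<Rightarrow> nat) \<Rightarrow> real" and y assume y: "y \<in> ?\<Omega>" and f: "\<And>z. \<bar>f z\<bar> \<le> 1 / 2"
  have "lipschitz 1 f"
  proof (rule lipschitz_from_neighbours)
    show "f a - f b \<le> 1" for a b using f[of a] f[of b] by linarith
  qed
  then have "lipschitz (1 * \<alpha> ^ t) (\<lambda>x. \<Sum>y\<in>?\<Omega>. mpow ?\<Omega> P t x y * f y)"
    by (intro lipschitz_mpow step \<alpha>) auto
  then have "(\<Sum>z\<in>?\<Omega>. mpow ?\<Omega> P t x z * f z) - (\<Sum>z\<in>?\<Omega>. mpow ?\<Omega> P t y z * f z)
      \<le> \<alpha> ^ t * real (hamming x y)" using x y by (simp add: lipschitz_def)
  also have "\<dots> \<le> \<alpha> ^ t * real (card V)"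
    using \<alpha> by (intro mult_left_mono of_nat_mono hamming_le) auto
  finally show "(\<Sum>z\<in>?\<Omega>. mpow ?\<Omega> P t x z * f z) - (\<Sum>z\<in>?\<Omega>. mpow ?\<Omega> P t y z * f z)
      \<le> real (card V) * \<alpha> ^ t" by (simp add: mult.commute)
qed

end

section \<open>Mixing time\<close>

text \<open>A single vertex is a proper part of \<open>V\<close>, so connectedness gives it a
  neighbour. This makes the truncated \<Delta> - 1 genuine and permits 1 + \<Delta> \<le> 2
  \<Delta>.\<close>

lemma max_degree_pos:
  assumes G: "simple_graph V adj" and C: "connected_graph V adj" and V: "2 \<le> card V"
  shows "1 \<le> max_degree V adj"
proof -
  have fin: "finite V" using G by (simp add: simple_graph_def)
  obtain w where w: "w \<in> V" using V by (metis card.empty ex_in_conv not_numeral_le_zero)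
  have "{w} \<noteq> V" using V by (metis is_singletonI is_singleton_altdef one_le_numeral le_antisym numeral_One numeral_eq_iff semiring_norm(85))
  then obtain b where b: "b \<in> V" "adj w b"
    using spanned_from_induced_connected[OF C[unfolded connected_graph_def] w] w
    unfolding spanned_from_def by (metis DiffD1 empty_subsetI insert_subset psubsetI singletonD singletonI)
  then have "0 < degree V adj w"
    unfolding degree_def using fin by (auto simp: card_gt_0_iff)
  also have "\<dots> \<le> max_degree V adj"
    unfolding max_degree_def using fin w by (intro Max_ge) auto
  finally show ?thesis by simp
qed

text \<open>This turns the constant in the assumption on \<open>q\<close> into the excess 1/4 of the
  contraction estimate; the factor 4 on the left is its inverse.\<close>

lemma neighbourhood_bound:
  assumes "2 \<le> k" "1 \<le> D"
  shows "4 * ((1 + real D) ^ k * (real k * (real k * 2 ^ k))) \<le> 2 ^ (k + 1) * real D ^ (2 * k) * real k ^ (2 * k + 1)"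
proof -
  have D: "(1 + real D) ^ k \<le> 2 ^ k * real D ^ (2 * k)"
  proof -
    have "(1 + real D) ^ k \<le> (2 * real D) ^ k" using assms by (intro power_mono) auto
    also have "\<dots> = 2 ^ k * real D ^ k" by (simp add: power_mult_distrib)
    also have "\<dots> \<le> 2 ^ k * real D ^ (2 * k)"
      using assms by (intro mult_left_mono power_increasing) auto
    finally show ?thesis .
  qed
  have "4 * ((1 + real D) ^ k * (real k * (real k * 2 ^ k)))
      \<le> 4 * ((2 ^ k * real D ^ (2 * k)) * (real k * (real k * 2 ^ k)))"
    using D by (intro mult_left_mono mult_right_mono) auto
  also have "\<dots> = 2 ^ (k + 1) * real D ^ (2 * k) * (real k ^ 2 * 2 ^ (k + 1))"
    by (simp add: power2_eq_square mult_ac)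
  also have "\<dots> \<le> 2 ^ (k + 1) * real D ^ (2 * k) * (real k ^ 2 * real k ^ (2 * k - 1))"
  proof -
    \<comment> \<open>\<open>k + 1 \<le> 2 * k - 1\<close> is exactly
      \<open>2 \<le> k\<close>.\<close>
    have "(2 :: real) ^ (k + 1) \<le> 2 ^ (2 * k - 1)" using assms by (intro power_increasing) auto
    also have "\<dots> \<le> real k ^ (2 * k - 1)" using assms by (intro power_mono) auto
    finally show ?thesis by (intro mult_left_mono) auto
  qed
  also have "real k ^ 2 * real k ^ (2 * k - 1) = real k ^ (2 * k + 1)"
    using assms by (simp flip: power_add)
  finally show ?thesis .
qed

text \<open>Since the mixing time is an integer, it is the floor of the claimed bound that has to suffice;
  this is where the rate \<open>3 / (4 n)\<close> instead of \<open>1 / (2 n)\<close> is needed.\<close>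
lemma geometric_decay_floor:
  fixes n \<epsilon> :: real
  assumes n: "3 \<le> n" and \<epsilon>: "0 < \<epsilon>" "\<epsilon> < 1"
  defines "t \<equiv> nat \<lfloor>2 * n * ln (n / \<epsilon>)\<rfloor>"
  shows "n * (1 - (1 - 1 / 4) / n) ^ t \<le> \<epsilon>" and "real t \<le> 2 * n * ln (n / \<epsilon>)"
proof -
  let ?l = "ln (n / \<epsilon>)"
  have "3 \<le> n / \<epsilon>" using n \<epsilon> by (simp add: le_divide_eq)
  then have "exp 1 \<le> n / \<epsilon>" using exp_le by linarith
  then have l: "1 \<le> ?l" using n \<epsilon> by (simp add: ln_ge_iff)
  have nl: "0 \<le> 2 * n * ?l" using n l by simp
  show "real t \<le> 2 * n * ?l" unfolding t_def using nl by (simp add: of_nat_floor)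
  have t: "2 * n * ?l - 1 \<le> real t" unfolding t_def using nl by linarith
  \<comment> \<open>The surplus \<open>n * ?l / 2\<close> is at least 3/2, which covers the 3/4 lost
    by rounding down; this uses that \<open>n\<close> is at least 3 and the logarithm at least
    1.\<close>
  have "n * ?l \<le> 3 / 4 * (2 * n * ?l - 1)"
    using mult_mono[OF n l] n by simp
  also have "\<dots> \<le> 3 / 4 * real t" using t by simp
  finally have lt: "?l \<le> real t * (3 / 4 / n)" using n by (simp add: field_simps)
  have "(1 - (1 - 1 / 4) / n) ^ t \<le> exp (- (3 / 4 / n)) ^ t"
    using exp_ge_add_one_self[of "- (3 / 4 / n)"] n by (intro power_mono) (auto simp: field_simps)
  also have "\<dots> = exp (- (real t * (3 / 4 / n)))" by (simp flip: exp_of_nat_mult)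
  also have "\<dots> \<le> exp (- ?l)" using lt by simp
  also have "\<dots> = \<epsilon> / n" using n \<epsilon> by (simp add: exp_minus)
  finally show "n * (1 - (1 - 1 / 4) / n) ^ t \<le> \<epsilon>" using n by (simp add: field_simps)
qed

theorem theorem2p7:
  fixes V :: "'v set" and adj :: "'v \<Rightarrow> 'v \<Rightarrow> bool" and k q :: nat
    and Sb :: "'v \<Rightarrow> 'v set" and lam \<epsilon> :: real
  assumes "simple_graph V adj"
    and "connected_graph V adj"
    and "2 \<le> k" and "k \<le> card V - 1"
    and "block_system V adj k Sb"
    and "lam > 1"
    and "real q \<ge> 2 ^ (k + 1) * real (max_degree V adj) ^ (2 * k) * real k ^ (2 * k + 1)
                   * lam powr (real (max_degree V adj) - 1 + 1 / real k)"
    and "0 < \<epsilon>" and "\<epsilon> < 1"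
  shows "real (mixing_time (configs V q) (block_dynamics V adj q lam Sb) (gibbs V adj q lam) \<epsilon>)
           \<le> 2 * real (card V) * ln (real (card V) / \<epsilon>)"
proof -
  let ?D = "max_degree V adj"
  define C where "C = 2 ^ (k + 1) * real ?D ^ (2 * k) * real k ^ (2 * k + 1)"
  let ?s = "real ?D - 1 + 1 / real k"
  let ?\<Omega> = "configs V q" and ?P = "block_dynamics V adj q lam Sb" and ?\<pi> = "gibbs V adj q lam"
  let ?t = "nat \<lfloor>2 * real (card V) * ln (real (card V) / \<epsilon>)\<rfloor>"
  have n: "3 \<le> card V" using assms(3,4) by linarith
  have D: "1 \<le> ?D" using max_degree_pos[OF assms(1,2)] n by linarith
  have C1: "1 \<le> C"
    unfolding C_def using D assms(3) by (intro mult_ge1_I one_le_power) auto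
  have lam_s: "1 \<le> lam powr ?s" using assms(3,6) D by (intro ge_one_powr_ge_zero) auto
  \<comment> \<open>The choice that makes \<open>\<rho> * real q\<close> equal to
    \<open>lam powr ?s\<close>; the assumption on \<open>q\<close> then reads
    \<open>C * \<rho> \<le> 1\<close>.\<close>
  define \<rho> where "\<rho> = lam powr ?s / real q"
  have qC: "C * lam powr ?s \<le> real q" using assms(7) by (simp add: C_def)
  have "1 * 1 \<le> C * lam powr ?s" using C1 lam_s by (intro mult_mono) auto
  then have q: "0 < q" using qC by (cases q) auto
  interpret potts V adj q lam
    using assms(1,6) q by unfold_locales auto
  have \<rho>0: "0 < \<rho>" using q lam_s assms(6) by (simp add: \<rho>_def)
  have \<rho>C: "C * \<rho> \<le> 1" using qC q by (simp add: \<rho>_def divide_le_eq)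
  have "1 * \<rho> \<le> C * \<rho>" using C1 \<rho>0 by (intro mult_right_mono) auto
  then have \<rho>1: "\<rho> \<le> 1" using \<rho>C by linarith
  have \<rho>q: "\<rho> * real q = lam powr ?s" using q by (simp add: \<rho>_def)
  have D1: "real (?D - 1) = real ?D - 1" using D by (simp add: of_nat_diff)
  have h1: "lam ^ (?D - 1) \<le> \<rho> * real q"
  proof -
    have "lam ^ (?D - 1) = lam powr (real ?D - 1)"
      unfolding D1[symmetric] using assms(6) by (intro powr_realpow[symmetric]) auto
    also have "\<dots> \<le> lam powr ?s" using assms(3,6) by (intro powr_mono) auto
    finally show ?thesis by (simp add: \<rho>q)
  qed
  have h2: "lam ^ (k * (?D - 1) + 1) \<le> (\<rho> * real q) ^ k"
  proof -
    have "(\<rho> * real q) ^ k = lam powr (?s * real k)"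
      unfolding \<rho>q using assms(6) by (simp add: powr_realpow[symmetric] powr_powr)
    \<comment> \<open>The summand \<open>1 / k\<close> of the exponent pays for the one extra edge
      of a block that is monochromatic as a whole.\<close>
    also have "?s * real k = real (k * (?D - 1) + 1)"
      using assms(3) D1 by (simp add: field_simps)
    also have "lam powr \<dots> = lam ^ (k * (?D - 1) + 1)" using assms(6) by (intro powr_realpow) auto
    finally show ?thesis by simp
  qed
  have h3: "(1 + real ?D) ^ k * (real k * (real k * 2 ^ k * \<rho>)) \<le> 1 / 4"
  proof -
    have "4 * ((1 + real ?D) ^ k * (real k * (real k * 2 ^ k))) * \<rho> \<le> C * \<rho>"
      unfolding C_def using neighbourhood_bound[OF assms(3) D] \<rho>0 by (intro mult_right_mono) auto
    then have "4 * ((1 + real ?D) ^ k * (real k * (real k * 2 ^ k))) * \<rho> \<le> 1" using \<rho>C by linarith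
    then show ?thesis by (simp add: mult.assoc)
  qed
  let ?\<alpha> = "1 - (1 - 1 / 4) / real (card V)"
  have \<alpha>0: "0 \<le> ?\<alpha>" using n by (simp add: field_simps)
  have stat: "(\<Sum>x\<in>?\<Omega>. ?\<pi> x * ?P x y) = ?\<pi> y" if "y \<in> ?\<Omega>" for y
    using assms(5) n that by (intro gibbs_stationary) (auto simp: block_system_def)
  have tv: "tv_dist ?\<Omega> (mpow ?\<Omega> ?P ?t x) ?\<pi> \<le> \<epsilon>" if x: "x \<in> ?\<Omega>" for x
  proof -
    have "tv_dist ?\<Omega> (mpow ?\<Omega> ?P ?t x) ?\<pi> \<le> real (card V) * ?\<alpha> ^ ?t"
      by (rule tv_dist_contracting_le[OF _ \<alpha>0 stat x])
         (rule block_dynamics_contracts[OF assms(5) \<rho>0 \<rho>1 h1 h2 h3])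
    also have "\<dots> \<le> \<epsilon>" using n assms(8,9) by (intro geometric_decay_floor(1)) auto
    finally show ?thesis .
  qed
  \<comment> \<open>\<open>mixing_time\<close> is a maximum over starting configurations, so
    nonemptiness is required before it can be bounded termwise.\<close>
  have "?\<Omega> \<noteq> {}"
    unfolding configs_eq_block_colourings using zero_block_colouring by blast
  then have "mixing_time ?\<Omega> ?P ?\<pi> \<epsilon> \<le> ?t"
    unfolding mixing_time_def using finite_configs tv
    by (subst Max_le_iff) (auto intro: Least_le)
  then have "real (mixing_time ?\<Omega> ?P ?\<pi> \<epsilon>) \<le> real ?t" by simp
  also have "\<dots> \<le> 2 * real (card V) * ln (real (card V) / \<epsilon>)"
    using n assms(8,9) by (intro geometric_decay_floor(2)) auto
  finally show ?thesis .
qed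

end
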